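(* Let $p>2$ be a real number. Then neither of the Banach spaces $l_p$ and $L_p[0,1]$ has the average distance property.
   Context: A rendezvous number of a metric space $(M,d)$ is a real number $r$ with the property that for each positive integer $n$ and all $x_1,\ldots,x_n\in M$ (not necessarily distinct) there exists $x\in M$ such that $\frac1n\sum_{k=1}^n d(x_k,x)=r$. A (real or complex) Banach space $X$ has the average distance property (ADP) if its unit sphere $\{x\in X:\|x\|=1\}$, with the metric $d(x,y)=\|x-y\|$, has a unique rendezvous number, i.e. there is exactly one real number that is a rendezvous number of the unit sphere. Here $l_p$ is the usual space of $p$-summable sequences and $L_p[0,1]$ the usual Lebesgue space on $[0,1]$, with real or complex scalars. *)

theory Defs
  imports "HOL-Analysis.Analysis"
begin

section \<open>Rendezvous numbers and the average distance property\<close>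

definition rendezvous_number :: "'a set \<Rightarrow> ('a \<Rightarrow> 'a \<Rightarrow> real) \<Rightarrow> real \<Rightarrow> bool" where
  "rendezvous_number M d r \<longleftrightarrow>
     (\<forall>n::nat. \<forall>xs::nat \<Rightarrow> 'a. 1 \<le> n \<longrightarrow> (\<forall>k\<in>{1..n}. xs k \<in> M) \<longrightarrow>
        (\<exists>x\<in>M. (1 / real n) * (\<Sum>k=1..n. d (xs k) x) = r))"

definition unit_sphere :: "'a set \<Rightarrow> ('a \<Rightarrow> real) \<Rightarrow> 'a set" where
  "unit_sphere X nrm = {x \<in> X. nrm x = 1}"

text \<open>
  The spaces below depend on the real parameter \<open>p\<close>, so they cannot be types of class \<^class>\<open>banach\<close>.
  A normed space is given by its carrier, its subtraction and its norm; these
  determine the unit sphere and its metric.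
\<close>

definition average_distance_property ::
    "'a set \<Rightarrow> ('a \<Rightarrow> 'a \<Rightarrow> 'a) \<Rightarrow> ('a \<Rightarrow> real) \<Rightarrow> bool" where
  "average_distance_property X sub nrm \<longleftrightarrow>
     (\<exists>!r::real. rendezvous_number (unit_sphere X nrm) (\<lambda>x y. nrm (sub x y)) r)"


section \<open>The sequence space \<open>l\<^sub>p\<close>\<close>

definition ell_space :: "real \<Rightarrow> (nat \<Rightarrow> 'a::real_normed_vector) set" where
  "ell_space p = {x. summable (\<lambda>n. norm (x n) powr p)}"

definition ell_diff :: "(nat \<Rightarrow> 'a::real_normed_vector) \<Rightarrow> (nat \<Rightarrow> 'a) \<Rightarrow> nat \<Rightarrow> 'a" where
  "ell_diff x y = (\<lambda>n. x n - y n)"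

definition ell_norm :: "real \<Rightarrow> (nat \<Rightarrow> 'a::real_normed_vector) \<Rightarrow> real" where
  "ell_norm p x = (\<Sum>n. norm (x n) powr p) powr (1 / p)"


section \<open>The Lebesgue space \<open>L\<^sub>p\<close>\<close>

definition Lp_fun :: "real \<Rightarrow> 'b measure \<Rightarrow> ('b \<Rightarrow> 'a::{banach,second_countable_topology}) set" where
  "Lp_fun p M = {f \<in> borel_measurable M. integrable M (\<lambda>t. norm (f t) powr p)}"

definition Lp_seminorm :: "real \<Rightarrow> 'b measure \<Rightarrow> ('b \<Rightarrow> 'a::{banach,second_countable_topology}) \<Rightarrow> real" where
  "Lp_seminorm p M f = (LINT t|M. norm (f t) powr p) powr (1 / p)"

definition Lp_rel :: "real \<Rightarrow> 'b measure \<Rightarrow>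
    (('b \<Rightarrow> 'a::{banach,second_countable_topology}) \<times> ('b \<Rightarrow> 'a)) set" where
  "Lp_rel p M = {(f, g). f \<in> Lp_fun p M \<and> g \<in> Lp_fun p M \<and> (AE t in M. f t = g t)}"

text \<open>
  Elements of \<open>L\<^sub>p\<close> are classes of functions modulo equality almost everywhere. Subtraction and
  norm are computed on representatives; independence of the choice is shown in
  \<open>Lp_diff_class\<close> and \<open>Lp_norm_class\<close>.
\<close>

definition Lp_space :: "real \<Rightarrow> 'b measure \<Rightarrow> ('b \<Rightarrow> 'a::{banach,second_countable_topology}) set set" where
  "Lp_space p M = Lp_fun p M // Lp_rel p M"

definition Lp_diff :: "real \<Rightarrow> 'b measure \<Rightarrow> ('b \<Rightarrow> 'a::{banach,second_countable_topology}) set \<Rightarrow>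
    ('b \<Rightarrow> 'a) set \<Rightarrow> ('b \<Rightarrow> 'a) set" where
  "Lp_diff p M F G = (\<Union>f\<in>F. \<Union>g\<in>G. Lp_rel p M `` {\<lambda>t. f t - g t})"

definition Lp_norm :: "real \<Rightarrow> 'b measure \<Rightarrow> ('b \<Rightarrow> 'a::{banach,second_countable_topology}) set \<Rightarrow> real" where
  "Lp_norm p M F = the_elem (Lp_seminorm p M ` F)"


section \<open>Well-definedness, and the norm metric\<close>

lemma Lp_fun_diff:
  assumes "1 \<le> p" "f \<in> Lp_fun p M" "g \<in> Lp_fun p M"
  shows "(\<lambda>t. f t - g t) \<in> Lp_fun p M"
proof -
  have [measurable]: "f \<in> borel_measurable M" "g \<in> borel_measurable M"
    using assms by (auto simp: Lp_fun_def)
  have int: "integrable M (\<lambda>t. norm (f t) powr p)" "integrable M (\<lambda>t. norm (g t) powr p)"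
    using assms by (auto simp: Lp_fun_def)
  have bound: "norm (f t - g t) powr p \<le> 2 powr p * (norm (f t) powr p + norm (g t) powr p)" for t
  proof -
    have "norm (f t - g t) \<le> 2 * max (norm (f t)) (norm (g t))"
      using norm_triangle_ineq4[of "f t" "g t"] by simp
    then have "norm (f t - g t) powr p \<le> (2 * max (norm (f t)) (norm (g t))) powr p"
      using assms by (intro powr_mono2) auto
    also have "\<dots> = 2 powr p * (max (norm (f t)) (norm (g t))) powr p"
      by (simp add: powr_mult le_max_iff_disj)
    also have "\<dots> \<le> 2 powr p * (norm (f t) powr p + norm (g t) powr p)"
      by (intro mult_left_mono) (auto simp: max_def)
    finally show ?thesis .
  qed
  have "integrable M (\<lambda>t. norm (f t - g t) powr p)"
    by (rule Bochner_Integration.integrable_bound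
        [where f = "\<lambda>t. 2 powr p * (norm (f t) powr p + norm (g t) powr p)"])
      (use int bound in \<open>auto intro!: AE_I2 simp: abs_of_nonneg\<close>)
  then show ?thesis
    by (auto simp: Lp_fun_def)
qed

lemma equiv_Lp_rel:
  fixes M :: "'b measure"
  shows "equiv (Lp_fun p M :: ('b \<Rightarrow> 'a::{banach,second_countable_topology}) set) (Lp_rel p M)"
    (is "equiv ?A ?R")
proof (rule equivI)
  show "?R \<subseteq> ?A \<times> ?A" "refl_on ?A ?R"
    by (auto simp: Lp_rel_def refl_on_def)
  show "sym ?R"
    by (auto simp: Lp_rel_def sym_def eq_commute)
  show "trans ?R"
  proof (rule transI)
    fix f g h :: "'b \<Rightarrow> 'a"
    assume *: "(f, g) \<in> ?R" "(g, h) \<in> ?R"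
    then have ae: "AE t in M. f t = g t" "AE t in M. g t = h t"
      by (auto simp: Lp_rel_def)
    have "AE t in M. f t = h t"
      using ae by eventually_elim simp
    then show "(f, h) \<in> ?R"
      using * by (auto simp: Lp_rel_def)
  qed
qed

lemma Lp_seminorm_cong:
  assumes "(f, g) \<in> Lp_rel p M"
  shows "Lp_seminorm p M f = Lp_seminorm p M g"
proof -
  have [measurable]: "f \<in> borel_measurable M" "g \<in> borel_measurable M"
    and ae: "AE t in M. f t = g t"
    using assms by (auto simp: Lp_rel_def Lp_fun_def)
  have "(LINT t|M. norm (f t) powr p) = (LINT t|M. norm (g t) powr p)"
    by (rule integral_cong_AE) (use ae in auto)
  then show ?thesis by (simp add: Lp_seminorm_def)
qed

lemma Lp_norm_class:
  assumes "f \<in> Lp_fun p M"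
  shows "Lp_norm p M (Lp_rel p M `` {f}) = Lp_seminorm p M f"
proof -
  have "f \<in> Lp_rel p M `` {f}"
    using assms by (auto simp: Lp_rel_def)
  moreover have "Lp_seminorm p M g = Lp_seminorm p M f" if "g \<in> Lp_rel p M `` {f}" for g
    using that by (intro Lp_seminorm_cong[symmetric]) simp
  ultimately have "Lp_seminorm p M ` (Lp_rel p M `` {f}) = {Lp_seminorm p M f}"
    by blast
  then show ?thesis by (simp add: Lp_norm_def)
qed

lemma Lp_diff_class:
  assumes "1 \<le> p" "f \<in> Lp_fun p M" "g \<in> Lp_fun p M"
  shows "Lp_diff p M (Lp_rel p M `` {f}) (Lp_rel p M `` {g}) = Lp_rel p M `` {\<lambda>t. f t - g t}"
  unfolding Lp_diff_def
proof (rule UN_equiv_class2[OF equiv_Lp_rel equiv_Lp_rel _ assms(2,3)], rule congruent2I')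
  fix f1 f2 g1 g2 :: "'a \<Rightarrow> 'b"
  assume *: "(f1, f2) \<in> Lp_rel p M" "(g1, g2) \<in> Lp_rel p M"
  then have ae: "AE t in M. f1 t = f2 t" "AE t in M. g1 t = g2 t"
    by (auto simp: Lp_rel_def)
  have "AE t in M. f1 t - g1 t = f2 t - g2 t"
    using ae by eventually_elim simp
  then have "(\<lambda>t. f1 t - g1 t, \<lambda>t. f2 t - g2 t) \<in> Lp_rel p M"
    using * assms(1) by (auto simp: Lp_rel_def intro!: Lp_fun_diff)
  then show "Lp_rel p M `` {\<lambda>t. f1 t - g1 t} = Lp_rel p M `` {\<lambda>t. f2 t - g2 t}"
    by (rule equiv_class_eq[OF equiv_Lp_rel])
qed

lemma Lp_seminorm_commute: "Lp_seminorm p M (\<lambda>t. f t - g t) = Lp_seminorm p M (\<lambda>t. g t - f t)"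
  by (simp add: Lp_seminorm_def norm_minus_commute)

lemma Lp_seminorm_eq_0_iff:
  assumes "1 \<le> p" "f \<in> Lp_fun p M"
  shows "Lp_seminorm p M f = 0 \<longleftrightarrow> (AE t in M. f t = 0)"
proof -
  have int: "integrable M (\<lambda>t. norm (f t) powr p)"
    using assms by (auto simp: Lp_fun_def)
  have "Lp_seminorm p M f = 0 \<longleftrightarrow> (LINT t|M. norm (f t) powr p) = 0"
    using assms by (simp add: Lp_seminorm_def)
  also have "\<dots> \<longleftrightarrow> (AE t in M. norm (f t) powr p = 0)"
    by (rule integral_nonneg_eq_0_iff_AE[OF int]) simp
  finally show ?thesis by simp
qed

lemma powr_convex_nonneg:
  fixes u v a b p :: real
  assumes p: "1 \<le> p" and uv: "0 \<le> u" "0 \<le> v" and ab: "0 < a" "0 < b" "a + b = 1"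
  shows "(a * u + b * v) powr p \<le> a * u powr p + b * v powr p"
proof -
  have le: "(c * w) powr p \<le> c * w powr p" if "0 < c" "c \<le> 1" "0 \<le> w" for c w :: real
  proof -
    have "c powr p \<le> c powr 1"
      using that p by (intro powr_mono') auto
    then show ?thesis
      using that by (simp add: powr_mult mult_right_mono)
  qed
  show ?thesis
  proof (cases "u = 0 \<or> v = 0")
    case True
    then show ?thesis using le[of a u] le[of b v] uv ab by auto
  next
    case False
    then show ?thesis
      using powr_convex[OF p] uv ab unfolding convex_on_def by simp
  qed
qed

lemma Lp_seminorm_triangle:
  assumes p: "1 \<le> p" and f: "f \<in> Lp_fun p M" and g: "g \<in> Lp_fun p M"
  shows "Lp_seminorm p M (\<lambda>t. f t - g t) \<le> Lp_seminorm p M f + Lp_seminorm p M g"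
proof (rule field_le_epsilon)
  fix e :: real assume e: "0 < e"
  define a where "a = Lp_seminorm p M f + e / 2"
  define b where "b = Lp_seminorm p M g + e / 2"
  have int: "integrable M (\<lambda>t. norm (f t) powr p)" "integrable M (\<lambda>t. norm (g t) powr p)"
    "integrable M (\<lambda>t. norm (f t - g t) powr p)"
    using f g Lp_fun_diff[OF p f g] by (auto simp: Lp_fun_def)
  have nn: "0 \<le> (LINT t|M. norm (h t) powr p)" for h :: "'a \<Rightarrow> 'b"
    by (rule Bochner_Integration.integral_nonneg) simp
  have a: "a > 0" and b: "b > 0"
    using e by (auto simp: a_def b_def Lp_seminorm_def intro!: add_nonneg_pos)
  have root: "(LINT t|M. norm (h t) powr p) = Lp_seminorm p M h powr p" for h :: "'a \<Rightarrow> 'b"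
    using p nn[of h] by (simp add: Lp_seminorm_def powr_powr)
  have le_a: "(LINT t|M. norm (f t) powr p) \<le> a powr p"
    unfolding root using p e by (intro powr_mono2) (auto simp: a_def Lp_seminorm_def)
  have le_b: "(LINT t|M. norm (g t) powr p) \<le> b powr p"
    unfolding root using p e by (intro powr_mono2) (auto simp: b_def Lp_seminorm_def)
  define A where "A = (a + b) powr p * (a / (a + b)) / a powr p"
  define B where "B = (a + b) powr p * (b / (a + b)) / b powr p"
  have AB: "A \<ge> 0" "B \<ge> 0"
    using a b by (auto simp: A_def B_def)
  have bound: "norm (f t - g t) powr p \<le> A * norm (f t) powr p + B * norm (g t) powr p" for t
  proof -
    define u where "u = norm (f t) / a"
    define v where "v = norm (g t) / b"
    have uv: "u \<ge> 0" "v \<ge> 0" using a b by (auto simp: u_def v_def)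
    have "norm (f t - g t) \<le> norm (f t) + norm (g t)"
      by (rule norm_triangle_ineq4)
    also have "\<dots> = (a + b) * ((a / (a + b)) * u + (b / (a + b)) * v)"
    proof -
      have "(a + b) * ((a / (a + b)) * u) = norm (f t)" "(a + b) * ((b / (a + b)) * v) = norm (g t)"
        using a b by (simp_all add: u_def v_def)
      then show ?thesis by (simp only: distrib_left)
    qed
    finally have "norm (f t - g t) powr p \<le> ((a + b) * ((a / (a + b)) * u + (b / (a + b)) * v)) powr p"
      using p by (intro powr_mono2) auto
    also have "\<dots> = (a + b) powr p * ((a / (a + b)) * u + (b / (a + b)) * v) powr p"
      using a b uv by (intro powr_mult) 
    also have "\<dots> \<le> (a + b) powr p * ((a / (a + b)) * u powr p + (b / (a + b)) * v powr p)"
    proof (rule mult_left_mono)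
      have "a / (a + b) + b / (a + b) = 1"
        using a b by (simp add: add_divide_distrib[symmetric])
      then show "((a / (a + b)) * u + (b / (a + b)) * v) powr p \<le> (a / (a + b)) * u powr p + (b / (a + b)) * v powr p"
        using p a b uv by (intro powr_convex_nonneg) auto
    qed simp
    also have "\<dots> = A * norm (f t) powr p + B * norm (g t) powr p"
      using a b by (simp add: A_def B_def u_def v_def powr_divide algebra_simps)
    finally show ?thesis .
  qed
  have "(LINT t|M. norm (f t - g t) powr p) \<le> (LINT t|M. A * norm (f t) powr p + B * norm (g t) powr p)"
    using int bound by (intro integral_mono) auto
  also have "\<dots> = A * (LINT t|M. norm (f t) powr p) + B * (LINT t|M. norm (g t) powr p)"
    using int by simp
  also have "\<dots> \<le> A * a powr p + B * b powr p"
    using AB le_a le_b by (intro add_mono mult_left_mono)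
  also have "\<dots> = (a + b) powr p * ((a / (a + b)) + (b / (a + b)))"
    using a b by (simp add: A_def B_def distrib_left)
  also have "\<dots> = (a + b) powr p"
    using a b by (simp add: add_divide_distrib[symmetric])
  finally have "Lp_seminorm p M (\<lambda>t. f t - g t) \<le> ((a + b) powr p) powr (1 / p)"
    unfolding Lp_seminorm_def using p nn by (intro powr_mono2) auto
  also have "\<dots> = a + b"
    using a b p by (simp add: powr_powr)
  finally show "Lp_seminorm p M (\<lambda>t. f t - g t) \<le> Lp_seminorm p M f + Lp_seminorm p M g + e"
    by (simp add: a_def b_def)
qed

lemma Lp_diff_in_space:
  assumes "1 \<le> p" "F \<in> Lp_space p M" "G \<in> Lp_space p M"
  shows "Lp_diff p M F G \<in> Lp_space p M"
proof -
  obtain f g where fg: "f \<in> Lp_fun p M" "g \<in> Lp_fun p M"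
    "F = Lp_rel p M `` {f}" "G = Lp_rel p M `` {g}"
    using assms(2,3) unfolding Lp_space_def by (blast elim: quotientE)
  show ?thesis
    unfolding fg(3,4) Lp_diff_class[OF assms(1) fg(1,2)] Lp_space_def
    by (rule quotientI[OF Lp_fun_diff[OF assms(1) fg(1,2)]])
qed

text \<open>
  The locale \<^locale>\<open>Metric_space\<close> also constrains the distance outside the carrier, where
  \<^const>\<open>Lp_norm\<close> is unspecified; hence the case distinction.
\<close>

lemma Metric_space_Lp_space:
  fixes M :: "'b measure"
  assumes p: "1 \<le> p"
  shows "Metric_space (Lp_space p M :: ('b \<Rightarrow> 'a::{banach,second_countable_topology}) set set)
    (\<lambda>F G. if F \<in> Lp_space p M \<and> G \<in> Lp_space p M then Lp_norm p M (Lp_diff p M F G) else 0)"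
proof -
  let ?c = "\<lambda>f. Lp_rel p M `` {f}"
  have rep: "\<exists>f. f \<in> Lp_fun p M \<and> F = ?c f" if "F \<in> Lp_space p M" for F :: "('b \<Rightarrow> 'a) set"
    using that unfolding Lp_space_def by (auto elim!: quotientE)
  have d: "Lp_norm p M (Lp_diff p M (?c f) (?c g)) = Lp_seminorm p M (\<lambda>t. f t - g t)"
    if "f \<in> Lp_fun p M" "g \<in> Lp_fun p M" for f g :: "'b \<Rightarrow> 'a"
    using that p by (simp add: Lp_diff_class Lp_norm_class Lp_fun_diff)
  have nonneg: "0 \<le> Lp_norm p M (Lp_diff p M F G)"
    if "F \<in> Lp_space p M" "G \<in> Lp_space p M" for F G :: "('b \<Rightarrow> 'a) set"
    using rep[OF that(1)] rep[OF that(2)] by (auto simp: d) (simp add: Lp_seminorm_def)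
  have commute: "Lp_norm p M (Lp_diff p M F G) = Lp_norm p M (Lp_diff p M G F)"
    if "F \<in> Lp_space p M" "G \<in> Lp_space p M" for F G :: "('b \<Rightarrow> 'a) set"
    using rep[OF that(1)] rep[OF that(2)] by (auto simp: d intro: Lp_seminorm_commute)
  have zero: "Lp_norm p M (Lp_diff p M F G) = 0 \<longleftrightarrow> F = G"
    if *: "F \<in> Lp_space p M" "G \<in> Lp_space p M" for F G :: "('b \<Rightarrow> 'a) set"
  proof -
    obtain f g where fg: "f \<in> Lp_fun p M" "g \<in> Lp_fun p M" "F = ?c f" "G = ?c g"
      using rep[OF *(1)] rep[OF *(2)] by auto
    have "Lp_norm p M (Lp_diff p M F G) = 0 \<longleftrightarrow> (f, g) \<in> Lp_rel p M"
      unfolding fg(3,4) d[OF fg(1,2)] Lp_seminorm_eq_0_iff[OF p Lp_fun_diff[OF p fg(1,2)]]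
      using fg(1,2) by (simp add: Lp_rel_def)
    also have "\<dots> \<longleftrightarrow> F = G"
      unfolding fg(3,4) by (rule eq_equiv_class_iff[OF equiv_Lp_rel fg(1,2), symmetric])
    finally show ?thesis .
  qed
  have triangle: "Lp_norm p M (Lp_diff p M F H)
      \<le> Lp_norm p M (Lp_diff p M F G) + Lp_norm p M (Lp_diff p M G H)"
    if *: "F \<in> Lp_space p M" "G \<in> Lp_space p M" "H \<in> Lp_space p M" for F G H :: "('b \<Rightarrow> 'a) set"
  proof -
    obtain f g h where fgh: "f \<in> Lp_fun p M" "g \<in> Lp_fun p M" "h \<in> Lp_fun p M"
      "F = ?c f" "G = ?c g" "H = ?c h"
      using rep[OF *(1)] rep[OF *(2)] rep[OF *(3)] by auto
    have "Lp_seminorm p M (\<lambda>t. (f t - g t) - (h t - g t))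
        \<le> Lp_seminorm p M (\<lambda>t. f t - g t) + Lp_seminorm p M (\<lambda>t. h t - g t)"
      by (rule Lp_seminorm_triangle[OF p Lp_fun_diff[OF p fgh(1,2)] Lp_fun_diff[OF p fgh(3,2)]])
    then show ?thesis
      unfolding fgh(4-6) d[OF fgh(1,3)] d[OF fgh(1,2)] d[OF fgh(2,3)] Lp_seminorm_commute[of p M g h]
      by simp
  qed
  show ?thesis
  proof (rule Metric_space.intro, goal_cases)
    case 1
    then show ?case by (simp add: nonneg)
  next
    case (2 F G)
    then show ?case using commute[of F G] by auto
  next
    case (3 F G)
    then show ?case using zero[of F G] by simp
  next
    case (4 F G H)
    then show ?case using triangle[of F G H] by simp
  qed
qed

lemma ell_space_eq_Lp_fun: "ell_space p = Lp_fun p (count_space UNIV)"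
  by (auto simp: ell_space_def Lp_fun_def integrable_count_space_nat_iff)

lemma ell_norm_eq_Lp_seminorm:
  assumes "x \<in> ell_space p"
  shows "ell_norm p x = Lp_seminorm p (count_space UNIV) x"
  using assms
  by (simp add: ell_space_def ell_norm_def Lp_seminorm_def integral_count_space_nat
      integrable_count_space_nat_iff)

lemma Metric_space_ell_space:
  assumes p: "1 \<le> p"
  shows "Metric_space (ell_space p :: (nat \<Rightarrow> 'a::{banach,second_countable_topology}) set)
    (\<lambda>x y. ell_norm p (ell_diff x y))"
proof
  fix x y z :: "nat \<Rightarrow> 'a"
  have diff: "ell_diff u v \<in> ell_space p" if "u \<in> ell_space p" "v \<in> ell_space p"
    for u v :: "nat \<Rightarrow> 'a"
    using that p unfolding ell_space_eq_Lp_fun ell_diff_def by (intro Lp_fun_diff)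
  show "0 \<le> ell_norm p (ell_diff x y)"
    by (simp add: ell_norm_def)
  show "ell_norm p (ell_diff x y) = ell_norm p (ell_diff y x)"
    by (simp add: ell_norm_def ell_diff_def norm_minus_commute)
  assume x: "x \<in> ell_space p" and y: "y \<in> ell_space p"
  have "ell_norm p (ell_diff x y) = 0 \<longleftrightarrow> (\<forall>n. ell_diff x y n = 0)"
    using diff[OF x y] p
    by (simp add: ell_norm_eq_Lp_seminorm Lp_seminorm_eq_0_iff ell_space_eq_Lp_fun AE_count_space)
  then show "ell_norm p (ell_diff x y) = 0 \<longleftrightarrow> x = y"
    by (auto simp: ell_diff_def)
  assume z: "z \<in> ell_space p"
  have "Lp_seminorm p (count_space UNIV) (\<lambda>n. ell_diff x y n - ell_diff z y n)
      \<le> Lp_seminorm p (count_space UNIV) (ell_diff x y) + Lp_seminorm p (count_space UNIV) (ell_diff z y)"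
    using diff[OF x y] diff[OF z y] p unfolding ell_space_eq_Lp_fun
    by (rule Lp_seminorm_triangle[rotated 1])
  moreover have "(\<lambda>n. ell_diff x y n - ell_diff z y n) = ell_diff x z"
    by (auto simp: ell_diff_def)
  moreover have "ell_norm p (ell_diff y z) = ell_norm p (ell_diff z y)"
    by (simp add: ell_norm_def ell_diff_def norm_minus_commute)
  ultimately show "ell_norm p (ell_diff x z) \<le> ell_norm p (ell_diff x y) + ell_norm p (ell_diff y z)"
    using diff x y z by (simp add: ell_norm_eq_Lp_seminorm)
qed

end

theory Submission
  imports Defs "HOL-Real_Asymp.Real_Asymp"
begin

text \<open>
  The only candidate for a rendezvous number is \<open>2\<^sup>1\<^sup>/\<^sup>p\<close>, and it fails to be attained.
  For \<open>n\<close> disjointly supported unit vectors \<open>f\<^sub>k\<close> and any unit vector \<open>x\<close>, the average of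
  \<open>\<parallel>f\<^sub>k - x\<parallel>\<close> is at most \<open>2\<^sup>1\<^sup>/\<^sup>p + o(1)\<close>, so no rendezvous number exceeds \<open>2\<^sup>1\<^sup>/\<^sup>p\<close>.

  On the other hand, cut the space into \<open>n\<close> blocks on which a strictly positive weight \<open>h\<close> has
  \<open>\<integral>h\<^sup>p = 1/n\<close>, and let \<open>f\<close> range over the \<open>2\<^sup>n\<close> functions \<open>\<plusminus>h\<close> with independent signs on the blocks.
  For large \<open>n\<close> the average of \<open>\<parallel>f - x\<parallel>\<close> exceeds \<open>2\<^sup>1\<^sup>/\<^sup>p\<close> for every unit vector \<open>x\<close>, which
  excludes the remaining numbers. Indeed \<open>\<parallel>f - x\<parallel>\<^sup>p = 2 + \<delta> + \<Sum>\<plusminus>b\<^sub>j\<close>, where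
  \<open>\<delta> = \<Sum>g\<^sub>j > 0\<close> is the gain in Clarkson's inequality for \<open>p > 2\<close>. A pointwise estimate
  gives \<open>b\<^sub>j\<^sup>2 \<le> g\<^sub>j (C/n + 4 m\<^sub>j)\<close>, with \<open>m\<^sub>j\<close> the mass of \<open>|x|\<^sup>p\<close> on the block. If \<open>\<delta>\<close> is
  small, the second-order expansion of \<open>t\<^sup>1\<^sup>/\<^sup>p\<close> shows that the gain in the mean beats the loss
  by concavity, the ratio of the two being \<open>1 : 1 - 1/p\<close>; otherwise the variance \<open>\<Sum>b\<^sub>j\<^sup>2\<close> is negligible for large \<open>n\<close>.
\<close>

section \<open>Averages over signs\<close>

text \<open>The remainder is little-o of \<open>y\<^sup>2\<close> at 0, so every positive
  \<open>\<epsilon>\<close> works on a small enough interval. The exponent will be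
  \<open>1 / p\<close> in the averages and \<open>p / 2\<close> in the pointwise estimates.\<close>

lemma powr_taylor_second_order:
  fixes \<alpha> \<epsilon> :: real
  assumes "\<epsilon> > 0"
  obtains \<eta> where "0 < \<eta>" "\<eta> < 1"
    "\<And>y. \<bar>y\<bar> \<le> \<eta> \<Longrightarrow> \<bar>(1 + y) powr \<alpha> - 1 - \<alpha> * y - \<alpha> * (\<alpha> - 1) / 2 * y\<^sup>2\<bar> \<le> \<epsilon> * y\<^sup>2"
proof -
  have "(\<lambda>y::real. (1 + y) powr \<alpha> - 1 - \<alpha> * y - \<alpha> * (\<alpha> - 1) / 2 * y\<^sup>2) \<in> o[at 0](\<lambda>y. y\<^sup>2)"
    by real_asymp
  then have "\<forall>\<^sub>F y in at 0. norm ((1 + y) powr \<alpha> - 1 - \<alpha> * y - \<alpha> * (\<alpha> - 1) / 2 * y\<^sup>2) \<le> \<epsilon> * norm (y\<^sup>2)"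
    by (rule landau_o.smallD) fact
  then obtain d where d: "d > 0" "\<And>y. y \<noteq> 0 \<Longrightarrow> \<bar>y\<bar> < d \<Longrightarrow>
     \<bar>(1 + y) powr \<alpha> - 1 - \<alpha> * y - \<alpha> * (\<alpha> - 1) / 2 * y\<^sup>2\<bar> \<le> \<epsilon> * y\<^sup>2"
    unfolding eventually_at by (auto simp: dist_real_def)
  show ?thesis
  proof (rule that[of "min (d/2) (1/2)"])
    show "0 < min (d/2) (1/2)" "min (d/2) (1/2) < 1" using d(1) by auto
    show "\<bar>(1 + y) powr \<alpha> - 1 - \<alpha> * y - \<alpha> * (\<alpha> - 1) / 2 * y\<^sup>2\<bar> \<le> \<epsilon> * y\<^sup>2"
      if "\<bar>y\<bar> \<le> min (d/2) (1/2)" for y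
      using d(2)[of y] that d(1) by (cases "y = 0") auto
  qed
qed

section \<open>Moments of sums with independent signs\<close>

lemma sum_Pow_insert:
  fixes F :: "'i set \<Rightarrow> 'b::comm_monoid_add"
  assumes "finite J" "x \<notin> J"
  shows "(\<Sum>S\<in>Pow (insert x J). F S) = (\<Sum>S\<in>Pow J. F S) + (\<Sum>S\<in>Pow J. F (insert x S))"
proof -
  have "inj_on (insert x) (Pow J)"
    using assms by (intro inj_on_inverseI[where g = "\<lambda>S. S - {x}"]) auto
  moreover have "Pow J \<inter> insert x ` Pow J = {}" using assms by auto
  ultimately show ?thesis
    using assms by (simp add: Pow_insert sum.union_disjoint sum.reindex)
qed

text \<open>\<open>S\<close> is the set of plus signs, so averaging over \<open>Pow J\<close> is the
  expectation of a Rademacher sum with coefficients \<open>b\<close>.\<close>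

definition signed_sum :: "'i set \<Rightarrow> ('i \<Rightarrow> real) \<Rightarrow> 'i set \<Rightarrow> real" where
  "signed_sum J b S = (\<Sum>j\<in>J. if j \<in> S then b j else - b j)"

lemma signed_sum_insert:
  assumes "finite J" "x \<notin> J"
  shows "S \<subseteq> J \<Longrightarrow> signed_sum (insert x J) b S = signed_sum J b S - b x"
    and "signed_sum (insert x J) b (insert x S) = signed_sum J b S + b x"
proof -
  show "S \<subseteq> J \<Longrightarrow> signed_sum (insert x J) b S = signed_sum J b S - b x"
    using assms by (auto simp: signed_sum_def)
  have "(\<Sum>j\<in>J. if j \<in> insert x S then b j else - b j) = (\<Sum>j\<in>J. if j \<in> S then b j else - b j)"
    using assms by (intro sum.cong) auto
  then show "signed_sum (insert x J) b (insert x S) = signed_sum J b S + b x"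
    using assms by (simp add: signed_sum_def)
qed

lemma abs_signed_sum_le: "\<bar>signed_sum J b S\<bar> \<le> (\<Sum>j\<in>J. \<bar>b j\<bar>)"
  unfolding signed_sum_def by (rule order_trans[OF sum_abs]) (auto intro!: sum_mono)

lemma sum_signed_sum:
  assumes "finite J"
  shows "(\<Sum>S\<in>Pow J. signed_sum J b S) = 0"
  using assms
proof (induction J)
  case (insert x J)
  have "(\<Sum>S\<in>Pow J. signed_sum (insert x J) b S) = (\<Sum>S\<in>Pow J. signed_sum J b S - b x)"
    using insert by (intro sum.cong) (auto simp: signed_sum_insert)
  then show ?case
    using insert by (simp add: sum_Pow_insert signed_sum_insert sum.distrib sum_subtractf)
qed (simp add: signed_sum_def)

text \<open>Independent signs are uncorrelated: pairing \<open>S\<close> with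
  \<open>insert x S\<close> cancels the cross terms in the two squares.\<close>

lemma sum_signed_sum_square:
  assumes "finite J"
  shows "(\<Sum>S\<in>Pow J. (signed_sum J b S)\<^sup>2) = 2 ^ card J * (\<Sum>j\<in>J. (b j)\<^sup>2)"
  using assms
proof (induction J)
  case (insert x J)
  have "(\<Sum>S\<in>Pow J. (signed_sum (insert x J) b S)\<^sup>2) = (\<Sum>S\<in>Pow J. (signed_sum J b S - b x)\<^sup>2)"
    using insert by (intro sum.cong) (auto simp: signed_sum_insert)
  then have "(\<Sum>S\<in>Pow (insert x J). (signed_sum (insert x J) b S)\<^sup>2)
      = (\<Sum>S\<in>Pow J. (signed_sum J b S - b x)\<^sup>2 + (signed_sum J b S + b x)\<^sup>2)"
    using insert by (simp add: sum_Pow_insert signed_sum_insert sum.distrib)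
  also have "\<dots> = (\<Sum>S\<in>Pow J. 2 * (signed_sum J b S)\<^sup>2 + 2 * (b x)\<^sup>2)"
    by (intro sum.cong) (auto simp: power2_diff power2_sum)
  also have "\<dots> = 2 * (\<Sum>S\<in>Pow J. (signed_sum J b S)\<^sup>2) + 2 * 2 ^ card J * (b x)\<^sup>2"
    using insert.hyps by (simp add: sum.distrib sum_distrib_left[symmetric] card_Pow)
  finally show ?case using insert.hyps by (simp add: insert.IH distrib_left)
qed (simp add: signed_sum_def)

section \<open>Linearised Cauchy-Schwarz inequality\<close>

text \<open>The best choice \<open>c = \<bar>b\<bar> / g\<close> turns the linear inequalities into
  a product bound. Together with the converse \<open>double_abs_le_of_square_le_mult\<close> this
  replaces Cauchy-Schwarz: the linear bounds are summed or integrated first, and \<open>c\<close> is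
  chosen afterwards.\<close>

lemma square_le_mult_of_forall_weighted_sum:
  fixes b g k :: real
  assumes "0 \<le> g" "0 < k" and le: "\<And>c. c > 0 \<Longrightarrow> 2 * \<bar>b\<bar> \<le> c * g + k / c"
  shows "b\<^sup>2 \<le> g * k"
proof (cases "b = 0")
  case False
  show ?thesis
  proof (cases "g = 0")
    case True
    \<comment> \<open>For \<open>g = 0\<close> this \<open>c\<close> yields
      \<open>2 * \<bar>b\<bar> \<le> \<bar>b\<bar>\<close>, which is absurd.\<close>
    then show ?thesis using le[of "k / \<bar>b\<bar>"] False \<open>k > 0\<close> by auto
  next
    case g: False
    then have "\<bar>b\<bar> \<le> k * g / \<bar>b\<bar>"
      using le[of "\<bar>b\<bar> / g"] False \<open>0 \<le> g\<close> by auto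
    then have "\<bar>b\<bar> * \<bar>b\<bar> \<le> k * g" using False by (simp add: pos_le_divide_eq)
    then show ?thesis by (simp add: power2_eq_square mult.commute)
  qed
qed (use assms in auto)

lemma double_abs_le_of_square_le_mult:
  fixes b g k c :: real
  assumes "0 \<le> g" "0 \<le> k" "0 < c" "b\<^sup>2 \<le> g * k"
  shows "2 * \<bar>b\<bar> \<le> c * g + k / c"
proof -
  define X Y where "X = c * g" and "Y = k / c"
  have XY: "X * Y = g * k" "0 \<le> X" "0 \<le> Y" using assms(1-3) by (simp_all add: X_def Y_def)
  have "(2 * \<bar>b\<bar>)\<^sup>2 = 4 * b\<^sup>2" by (simp add: power_mult_distrib)
  also have "\<dots> \<le> 4 * (X * Y)" unfolding XY(1) using assms(4) by linarith
  also have "\<dots> = (X + Y)\<^sup>2 - (X - Y)\<^sup>2" by (simp add: power2_eq_square algebra_simps)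
  also have "\<dots> \<le> (X + Y)\<^sup>2" by simp
  finally have "2 * \<bar>b\<bar> \<le> X + Y" by (rule power2_le_imp_le) (use XY in simp)
  then show ?thesis by (simp add: X_def Y_def)
qed

lemma one_minus_abs_le_powr:
  fixes t \<theta> :: real
  assumes "0 \<le> t" "0 < \<theta>" "\<theta> \<le> 1"
  shows "1 - \<bar>t - 1\<bar> \<le> t powr \<theta>"
proof (cases "t \<le> 1")
  case True
  then have "t powr 1 \<le> t powr \<theta>" using assms by (intro powr_mono') auto
  then show ?thesis using True assms by simp
next
  case False
  then have "1 \<le> t powr \<theta>" using assms by (intro ge_one_powr_ge_zero) auto
  then show ?thesis using False by simp
qed

text \<open>What the averaging retains of a unit vector \<open>x\<close>: on block \<open>j\<close>,
  \<open>m j\<close> is its mass, and \<open>g j\<close>, \<open>b j\<close> are the integrals of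
  \<open>parallel_gain\<close> and \<open>parallel_diff\<close>. The quantity in the last clause
  will be the integral of a p-th power of a norm.\<close>

definition block_estimates ::
    "real \<Rightarrow> (real \<Rightarrow> real) \<Rightarrow> nat \<Rightarrow> (nat \<Rightarrow> real) \<Rightarrow> (nat \<Rightarrow> real) \<Rightarrow> (nat \<Rightarrow> real) \<Rightarrow> bool" where
  "block_estimates C D n b g m \<longleftrightarrow>
     (\<forall>j<n. 0 \<le> g j) \<and> (\<forall>j<n. 0 \<le> m j) \<and> (\<Sum>j<n. m j) = 1 \<and> 0 < (\<Sum>j<n. g j) \<and>
     (\<forall>j<n. (b j)\<^sup>2 \<le> g j * (C / n + 4 * m j)) \<and>
     (\<forall>j<n. \<forall>\<eta>>0. g j \<le> D \<eta> / n + \<eta> * m j) \<and>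
     (\<forall>S\<subseteq>{..<n}. 0 \<le> 2 + (\<Sum>j<n. g j) + signed_sum {..<n} b S)"

text \<open>The order of quantifiers is the point: \<open>n\<close> depends on \<open>p\<close>,
  \<open>C\<close> and \<open>D\<close> only, so one family of signed vectors serves all unit
  vectors. The threshold \<open>\<delta>0\<close> separates the regime of the expansion from that of
  small variance.\<close>

lemma signed_average_gt:
  fixes p C :: real and D :: "real \<Rightarrow> real"
  assumes p: "p > 2" and C: "C > 0" and D: "\<forall>\<eta>>0. D \<eta> \<ge> 0"
  obtains n :: nat where "n \<ge> 1"
    "\<forall>b g m. block_estimates C D n b g m \<longrightarrow>
      2 ^ n * 2 powr (1 / p) < (\<Sum>S\<in>Pow {..<n}. (2 + (\<Sum>j<n. g j) + signed_sum {..<n} b S) powr (1 / p))"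
proof -
  define \<theta> where "\<theta> = 1 / p"
  have \<theta>: "0 < \<theta>" "\<theta> < 1" using p by (auto simp: \<theta>_def)
  \<comment> \<open>The quadratic Taylor coefficient, up to sign, plus slack for the remainder.
    Without slack \<open>4 * K\<close> would be \<open>2 * \<theta> - 2 * \<theta>\<^sup>2\<close>;
    the slack takes half of this margin below \<open>2 * \<theta>\<close>, and the other half
    absorbs \<open>\<delta>\<close> and \<open>C / n\<close> in \<open>gain\<close>.\<close>
  define K where "K = \<theta> * (1 - \<theta>) / 2 + \<theta>\<^sup>2 / 4"
  have K4: "4 * K = 2 * \<theta> - \<theta>\<^sup>2" by (simp add: K_def field_simps power2_eq_square)
  have K0: "0 < K" using \<theta> by (simp add: K_def add_pos_pos)
  have K1: "2 * K \<le> \<theta>" using K4 zero_le_power2[of \<theta>] by linarith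
  have "0 < \<theta>\<^sup>2 / 4" using \<theta> by simp
  from powr_taylor_second_order[OF this, of \<theta>] obtain \<epsilon> where \<epsilon>: "0 < \<epsilon>" "\<epsilon> < 1" and
    tay: "\<And>y. \<bar>y\<bar> \<le> \<epsilon> \<Longrightarrow>
      \<bar>(1 + y) powr \<theta> - 1 - \<theta> * y - \<theta> * (\<theta> - 1) / 2 * y\<^sup>2\<bar> \<le> \<theta>\<^sup>2 / 4 * y\<^sup>2" by blast
  have tay': "1 + \<theta> * y - K * y\<^sup>2 \<le> (1 + y) powr \<theta>" if "\<bar>y\<bar> \<le> \<epsilon>" for y
  proof -
    have "K * y\<^sup>2 = \<theta>\<^sup>2 / 4 * y\<^sup>2 - \<theta> * (\<theta> - 1) / 2 * y\<^sup>2"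
      by (simp add: K_def field_simps)
    then show ?thesis using tay[OF that] by linarith
  qed
  \<comment> \<open>The bound \<open>\<theta> / 2\<close> serves \<open>gain\<close>; the other two
    keep \<open>\<delta>\<close> and the sum of the \<open>\<bar>b j\<bar>\<close> below
    \<open>\<epsilon>\<close>, the range of the expansion.\<close>
  define \<delta>0 where "\<delta>0 = min (\<theta> / 2) (min \<epsilon> (\<epsilon>\<^sup>2 / (C + 4)))"
  have "\<delta>0 \<le> \<epsilon>\<^sup>2 / (C + 4)" "0 < \<epsilon>\<^sup>2 / (C + 4)" using \<epsilon> C by (simp_all add: \<delta>0_def)
  then have "\<delta>0 * (C + 4) \<le> \<epsilon>\<^sup>2" using C by (simp add: pos_le_divide_eq)
  moreover have "0 < \<delta>0" using \<theta> \<epsilon> C by (simp add: \<delta>0_def)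
  moreover have "\<delta>0 \<le> \<theta> / 2" "\<delta>0 \<le> \<epsilon>" unfolding \<delta>0_def by linarith+
  ultimately have \<delta>0: "0 < \<delta>0" "\<delta>0 \<le> \<theta> / 2" "\<delta>0 \<le> \<epsilon>" "\<delta>0 * (C + 4) \<le> \<epsilon>\<^sup>2"
    by blast+
  \<comment> \<open>Half the amount by which the power falls short of 1, so that the growth factor
    \<open>(1 + \<delta>0 / 2) powr \<theta>\<close> survives a relative loss of
    \<open>\<kappa>\<close>.\<close>
  define \<kappa> where "\<kappa> = (1 - (1 + \<delta>0 / 2) powr - \<theta>) / 2"
  have pw: "0 < (1 + \<delta>0 / 2) powr - \<theta>" "(1 + \<delta>0 / 2) powr - \<theta> < 1"
    using \<delta>0 \<theta> by (auto simp: powr_less_one)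
  have "2 * \<kappa> = 1 - (1 + \<delta>0 / 2) powr - \<theta>" by (simp add: \<kappa>_def)
  then have \<kappa>: "0 < \<kappa>" "\<kappa> < 1" using pw by linarith+
  have \<kappa>big: "1 < (1 + \<delta>0 / 2) powr \<theta> * (1 - \<kappa>)"
  proof -
    have "1 - \<kappa> > (1 + \<delta>0 / 2) powr - \<theta>" using pw by (simp add: \<kappa>_def field_simps)
    then have "(1 + \<delta>0 / 2) powr \<theta> * (1 - \<kappa>) > (1 + \<delta>0 / 2) powr \<theta> * (1 + \<delta>0 / 2) powr - \<theta>"
      using \<delta>0 by (intro mult_strict_left_mono) auto
    then show ?thesis using \<delta>0 by (simp add: powr_minus)
  qed
  define \<eta> where "\<eta> = \<kappa>\<^sup>2 / 16"
  have \<eta>: "0 < \<eta>" using \<kappa> by (simp add: \<eta>_def)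
  \<comment> \<open>The three summands yield \<open>nC\<close>, \<open>nD\<close> and
    \<open>nE\<close> in turn. With \<open>4 * \<eta> = \<kappa>\<^sup>2 / 4\<close>, the last two
    bring the variance below \<open>\<kappa>\<^sup>2\<close>.\<close>
  define B where "B = C / \<theta> + 4 * (D 1 + 1) * C / \<kappa>\<^sup>2 + 16 * D \<eta> / \<kappa>\<^sup>2"
  obtain n0 :: nat where n0: "B < n0" using reals_Archimedean2 by blast
  define n where "n = Suc n0"
  have nB: "B < n" and n1: "n \<ge> 1" using n0 by (auto simp: n_def)
  have Bparts: "0 \<le> C / \<theta>" "0 \<le> 4 * (D 1 + 1) * C / \<kappa>\<^sup>2" "0 \<le> 16 * D \<eta> / \<kappa>\<^sup>2"
    using C \<theta> \<kappa> D \<eta> by auto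
  have nC: "C / n < \<theta>"
  proof -
    have "C / \<theta> < n" using nB Bparts by (simp add: B_def)
    then show ?thesis using \<theta> n1 by (simp add: field_simps)
  qed
  have nD: "(D 1 + 1) * (C / n) \<le> \<kappa>\<^sup>2 / 4"
  proof -
    have "4 * (D 1 + 1) * C / \<kappa>\<^sup>2 < n" using nB Bparts by (simp add: B_def)
    then show ?thesis using \<kappa> n1 by (simp add: field_simps)
  qed
  have nE: "4 * (D \<eta> / n) \<le> \<kappa>\<^sup>2 / 4"
  proof -
    have "16 * D \<eta> / \<kappa>\<^sup>2 < n" using nB Bparts by (simp add: B_def)
    then show ?thesis using \<kappa> n1 by (simp add: field_simps)
  qed
  show thesis
  proof (rule that[OF n1], intro allI impI)
    fix b g m :: "nat \<Rightarrow> real"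
    assume be: "block_estimates C D n b g m"
    have g: "0 \<le> g j" and m: "0 \<le> m j" and bg: "(b j)\<^sup>2 \<le> g j * (C / n + 4 * m j)" if "j < n" for j
      using be that by (simp_all add: block_estimates_def)
    have m1: "(\<Sum>j<n. m j) = 1" and gpos: "0 < (\<Sum>j<n. g j)"
      and gm: "\<And>j \<eta>. j < n \<Longrightarrow> \<eta> > 0 \<Longrightarrow> g j \<le> D \<eta> / n + \<eta> * m j"
      and W0: "\<And>S. S \<subseteq> {..<n} \<Longrightarrow> 0 \<le> 2 + (\<Sum>j<n. g j) + signed_sum {..<n} b S"
      using be by (simp_all add: block_estimates_def)
    define \<delta> where "\<delta> = (\<Sum>j<n. g j)"
    define s where "s = signed_sum {..<n} b"
    define V where "V = (\<Sum>j<n. (b j)\<^sup>2)"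
    have V0: "0 \<le> V" by (simp add: V_def sum_nonneg)
    have s0: "(\<Sum>S\<in>Pow {..<n}. s S) = 0" by (simp add: s_def sum_signed_sum)
    have s2: "(\<Sum>S\<in>Pow {..<n}. (s S)\<^sup>2) = 2 ^ n * V" by (simp add: s_def V_def sum_signed_sum_square)
    have \<delta>: "0 < \<delta>" using gpos by (simp add: \<delta>_def)
    have mj1: "m j \<le> 1" if "j < n" for j
      using member_le_sum[of j "{..<n}" m] that m m1 by auto
    have VC: "V \<le> \<delta> * (C / n + 4)"
    proof -
      have "V \<le> (\<Sum>j<n. g j * (C / n + 4))"
        unfolding V_def
      proof (rule sum_mono)
        fix j assume "j \<in> {..<n}"
        then have j: "j < n" by simp
        have "g j * (C / n + 4 * m j) \<le> g j * (C / n + 4)"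
          using g[OF j] mj1[OF j] by (intro mult_left_mono) auto
        then show "(b j)\<^sup>2 \<le> g j * (C / n + 4)" using bg[OF j] by simp
      qed
      then show ?thesis by (simp add: \<delta>_def sum_distrib_right)
    qed
    have W: "0 \<le> 2 + \<delta> + s S" if "S \<in> Pow {..<n}" for S using W0[of S] that by (simp add: \<delta>_def s_def)
    have "2 ^ n * 2 powr \<theta> < (\<Sum>S\<in>Pow {..<n}. (2 + \<delta> + s S) powr \<theta>)"
    proof (cases "\<delta> \<le> \<delta>0")
      case True
      have bsum: "(\<Sum>j<n. \<bar>b j\<bar>) \<le> \<epsilon>"
      proof -
        have "(\<Sum>j<n. \<bar>b j\<bar>)\<^sup>2 \<le> \<delta> * (C + 4)"
        proof (rule square_le_mult_of_forall_weighted_sum)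
          fix c :: real assume c: "c > 0"
          have "2 * (\<Sum>j<n. \<bar>b j\<bar>) = (\<Sum>j<n. 2 * \<bar>b j\<bar>)" by (simp add: sum_distrib_left)
          also have "\<dots> \<le> (\<Sum>j<n. c * g j + (C / n + 4 * m j) / c)"
            using g m bg C c by (intro sum_mono double_abs_le_of_square_le_mult) auto
          also have "\<dots> = c * \<delta> + ((\<Sum>j<n. C / n) + 4 * (\<Sum>j<n. m j)) / c"
            by (simp only: sum.distrib sum_distrib_left \<delta>_def sum_divide_distrib[symmetric])
          also have "\<dots> = c * \<delta> + (C + 4) / c" using m1 n1 by simp
          finally show "2 * \<bar>\<Sum>j<n. \<bar>b j\<bar>\<bar> \<le> c * \<delta> + (C + 4) / c" by (simp add: sum_nonneg)
        qed (use \<delta> C in auto)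
        also have "\<dots> \<le> \<delta>0 * (C + 4)" using True C by (intro mult_right_mono) auto
        also have "\<dots> \<le> \<epsilon>\<^sup>2" by (rule \<delta>0)
        finally show ?thesis by (rule power2_le_imp_le) (use \<epsilon> in auto)
      qed
      define u where "u = (\<lambda>S. (\<delta> + s S) / 2)"
      have u: "\<bar>u S\<bar> \<le> \<epsilon>" for S
        using abs_signed_sum_le[of "{..<n}" b S] bsum True \<delta> \<delta>0 unfolding u_def s_def by (simp add: abs_le_iff)
      have Wu: "(2 + \<delta> + s S) powr \<theta> = 2 powr \<theta> * (1 + u S) powr \<theta>" for S
      proof -
        have "2 + \<delta> + s S = 2 * (1 + u S)" by (simp add: u_def field_simps)
        then show ?thesis by (simp only: powr_mult)
      qed
      have su: "(\<Sum>S\<in>Pow {..<n}. u S) = 2 ^ n * (\<delta> / 2)"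
        using s0 by (simp add: u_def sum_divide_distrib[symmetric] sum.distrib card_Pow)
      have su2: "(\<Sum>S\<in>Pow {..<n}. (u S)\<^sup>2) = 2 ^ n * ((\<delta>\<^sup>2 + V) / 4)"
      proof -
        have "(\<Sum>S\<in>Pow {..<n}. (u S)\<^sup>2) = (\<Sum>S\<in>Pow {..<n}. \<delta>\<^sup>2 / 4 + \<delta> / 2 * s S + (s S)\<^sup>2 / 4)"
          by (intro sum.cong) (auto simp: u_def power2_eq_square field_simps)
        also have "\<dots> = 2 ^ n * (\<delta>\<^sup>2 / 4) + \<delta> / 2 * (\<Sum>S\<in>Pow {..<n}. s S) + (\<Sum>S\<in>Pow {..<n}. (s S)\<^sup>2) / 4"
          by (simp add: sum.distrib card_Pow sum_distrib_left sum_divide_distrib)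
        finally show ?thesis by (simp add: s0 s2 field_simps)
      qed
      have gain: "0 < \<theta> * (\<delta> / 2) - K * ((\<delta>\<^sup>2 + V) / 4)"
      proof -
        \<comment> \<open>By \<open>VC\<close>, the loss \<open>K * (\<delta>\<^sup>2 + V)\<close>
          is at most \<open>\<delta>\<close> times this left-hand side, and the mean gain is
          \<open>\<delta>\<close> times the right-hand side, both up to a factor 4.\<close>
        have "K * (\<delta> + C / n + 4) < 2 * \<theta>"
        proof -
          have "\<delta> + C / n \<le> \<theta> / 2 + \<theta>" using True \<delta>0 nC by linarith
          then have "K * (\<delta> + C / n) \<le> K * (\<theta> / 2 + \<theta>)" using K0 by (intro mult_left_mono) auto
          also have "\<dots> = (2 * K) * (3 / 4 * \<theta>)" by simp
          also have "\<dots> \<le> \<theta> * (3 / 4 * \<theta>)" using K1 \<theta> by (intro mult_right_mono) auto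
          also have "\<dots> < \<theta>\<^sup>2" using \<theta> by (simp add: power2_eq_square)
          finally show ?thesis using K4 by (simp add: distrib_left)
        qed
        then have "\<delta> * (K * (\<delta> + C / n + 4)) < \<delta> * (2 * \<theta>)" using \<delta> by simp
        moreover have "K * (\<delta>\<^sup>2 + V) \<le> K * (\<delta>\<^sup>2 + \<delta> * (C / n + 4))"
          using VC K0 by (intro mult_left_mono) auto
        moreover have "K * (\<delta>\<^sup>2 + \<delta> * (C / n + 4)) = \<delta> * (K * (\<delta> + C / n + 4))"
          by (simp add: power2_eq_square algebra_simps)
        ultimately have "K * (\<delta>\<^sup>2 + V) < \<delta> * (2 * \<theta>)" by linarith
        then show ?thesis by (simp add: algebra_simps)
      qed
      have "(2::real) ^ n < 2 ^ n * (1 + (\<theta> * (\<delta> / 2) - K * ((\<delta>\<^sup>2 + V) / 4)))" using gain by simp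
      also have "\<dots> = 2 ^ n + \<theta> * (\<Sum>S\<in>Pow {..<n}. u S) - K * (\<Sum>S\<in>Pow {..<n}. (u S)\<^sup>2)"
        by (simp add: su su2 algebra_simps)
      also have "\<dots> = (\<Sum>S\<in>Pow {..<n}. 1 + \<theta> * u S - K * (u S)\<^sup>2)"
        by (simp add: sum.distrib sum_subtractf card_Pow sum_distrib_left)
      also have "\<dots> \<le> (\<Sum>S\<in>Pow {..<n}. (1 + u S) powr \<theta>)" using u by (intro sum_mono tay')
      finally show ?thesis by (simp add: Wu sum_distrib_left[symmetric])
    next
      case False
      define \<mu> where "\<mu> = 2 + \<delta>"
      have \<mu>: "\<mu> \<ge> 2" "\<mu> > 2 + \<delta>0" using \<delta> False by (auto simp: \<mu>_def)
      have Vsmall: "V \<le> \<kappa>\<^sup>2"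
      proof -
        have "V \<le> (\<Sum>j<n. g j * (C / n) + 4 * ((D \<eta> / n + \<eta>) * m j))"
          unfolding V_def
        proof (rule sum_mono)
          fix j assume "j \<in> {..<n}"
          then have j: "j < n" by simp
          \<comment> \<open>In \<open>g j * m j\<close> the mass hidden in the bound for
            \<open>g j\<close> is replaced by 1, while the other one is kept, so that the sum over
            the blocks does not grow with \<open>n\<close>.\<close>
          have "\<eta> * m j \<le> \<eta> * 1" using mj1[OF j] \<eta> by (intro mult_left_mono) auto
          then have "g j \<le> D \<eta> / n + \<eta>" using gm[OF j \<eta>] by simp
          then have "g j * m j \<le> (D \<eta> / n + \<eta>) * m j" using m[OF j] by (intro mult_right_mono)
          then show "(b j)\<^sup>2 \<le> g j * (C / n) + 4 * ((D \<eta> / n + \<eta>) * m j)"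
            using bg[OF j] by (simp add: distrib_left)
        qed
        also have "\<dots> = \<delta> * (C / n) + 4 * ((D \<eta> / n + \<eta>) * (\<Sum>j<n. m j))"
          by (simp only: sum.distrib sum_distrib_left sum_distrib_right \<delta>_def)
        also have "\<dots> = \<delta> * (C / n) + 4 * (D \<eta> / n) + \<kappa>\<^sup>2 / 4" by (simp add: m1 \<eta>_def)
        finally have VE: "V \<le> \<delta> * (C / n) + 4 * (D \<eta> / n) + \<kappa>\<^sup>2 / 4" .
        have "\<delta> * (C / n) \<le> (D 1 + 1) * (C / n)"
        proof (rule mult_right_mono)
          have "\<delta> \<le> (\<Sum>j<n. D 1 / n + 1 * m j)" unfolding \<delta>_def by (intro sum_mono gm) auto
          also have "\<dots> = D 1 + 1" using n1 m1 by (simp add: sum.distrib)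
          finally show "\<delta> \<le> D 1 + 1" .
        qed (use C in auto)
        then show ?thesis using VE nD nE zero_le_power2[of \<kappa>] by linarith
      qed
      have pt: "\<mu> powr \<theta> * (1 - \<kappa> / 2 - (s S)\<^sup>2 / (2 * \<kappa> * \<mu>\<^sup>2)) \<le> (2 + \<delta> + s S) powr \<theta>"
        if S: "S \<in> Pow {..<n}" for S
      proof -
        define t where "t = (2 + \<delta> + s S) / \<mu>"
        have t: "0 \<le> t" "2 + \<delta> + s S = \<mu> * t" using W[OF S] \<mu> by (auto simp: t_def)
        have ts: "t - 1 = s S / \<mu>" using \<mu> by (simp add: t_def \<mu>_def field_simps)
        \<comment> \<open>Trades the absolute deviation for its square, whose sum over all signs is
          known.\<close>
        have "2 * \<bar>t - 1\<bar> \<le> \<kappa> * 1 + (t - 1)\<^sup>2 / \<kappa>"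
          using \<kappa> by (intro double_abs_le_of_square_le_mult) auto
        then have "1 - \<kappa> / 2 - (s S)\<^sup>2 / (2 * \<kappa> * \<mu>\<^sup>2) \<le> 1 - \<bar>t - 1\<bar>"
          by (simp add: ts power_divide field_simps)
        also have "\<dots> \<le> t powr \<theta>" using t \<theta> by (intro one_minus_abs_le_powr) auto
        finally show ?thesis using t \<mu> by (simp add: powr_mult mult_left_mono)
      qed
      have "2 ^ n * 2 powr \<theta> < 2 ^ n * (2 powr \<theta> * ((1 + \<delta>0 / 2) powr \<theta> * (1 - \<kappa>)))"
        using \<kappa>big by simp
      also have "\<dots> = 2 ^ n * ((2 + \<delta>0) powr \<theta> * (1 - \<kappa>))"
      proof -
        have "2 + \<delta>0 = 2 * (1 + \<delta>0 / 2)" by simp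
        then show ?thesis using \<delta>0 by (simp only: powr_mult mult.assoc)
      qed
      also have "\<dots> \<le> 2 ^ n * (\<mu> powr \<theta> * (1 - \<kappa>))"
        using \<mu> \<delta>0 \<theta> \<kappa> by (intro mult_left_mono mult_right_mono powr_mono2) auto
      also have "\<dots> \<le> 2 ^ n * (\<mu> powr \<theta> * (1 - \<kappa> / 2 - V / (2 * \<kappa> * \<mu>\<^sup>2)))"
      proof (intro mult_left_mono)
        have "V / (2 * \<kappa> * \<mu>\<^sup>2) \<le> \<kappa>\<^sup>2 / (2 * \<kappa> * \<mu>\<^sup>2)"
          using Vsmall \<kappa> \<mu> by (intro divide_right_mono) auto
        also have "\<dots> = \<kappa> / 2 / \<mu>\<^sup>2" using \<kappa> by (simp add: power2_eq_square)
        also have "\<dots> \<le> \<kappa> / 2 / 1" using \<kappa> \<mu> by (intro divide_left_mono) (auto simp: one_le_power)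
        finally show "1 - \<kappa> \<le> 1 - \<kappa> / 2 - V / (2 * \<kappa> * \<mu>\<^sup>2)" by simp
      qed auto
      also have "\<dots> = (\<Sum>S\<in>Pow {..<n}. \<mu> powr \<theta> * (1 - \<kappa> / 2 - (s S)\<^sup>2 / (2 * \<kappa> * \<mu>\<^sup>2)))"
        unfolding sum_distrib_left[symmetric] sum_subtractf sum_divide_distrib[symmetric] s2
        by (simp add: card_Pow right_diff_distrib ac_simps)
      also have "\<dots> \<le> (\<Sum>S\<in>Pow {..<n}. (2 + \<delta> + s S) powr \<theta>)" by (intro sum_mono pt)
      finally show ?thesis .
    qed
    then show "2 ^ n * 2 powr (1 / p)
      < (\<Sum>S\<in>Pow {..<n}. (2 + (\<Sum>j<n. g j) + signed_sum {..<n} b S) powr (1 / p))"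
      by (simp add: \<theta>_def \<delta>_def s_def)
  qed
qed

section \<open>Pointwise estimates\<close>

text \<open>Splitting off one factor from \<open>(1 + v) powr q\<close> and \<open>v powr q\<close>
  bounds the gap below by \<open>v\<close> times a difference of powers with exponent
  \<open>q - 1\<close>. For \<open>v \<le> R\<close> the ratio \<open>v / (1 + v)\<close> stays away
  from 1, which makes the gap at least linear in \<open>v\<close>.\<close>

lemma powr_superadditive_gap:
  fixes q v R :: real
  assumes q: "1 < q" and v: "0 \<le> v" "v \<le> R"
  shows "v * (1 - (R / (1 + R)) powr (q - 1)) \<le> (1 + v) powr q - 1 - v powr q"
proof -
  have e: "x powr q = x powr (q - 1) * x" if "0 \<le> x" for x :: real
    using that powr_add[of x "q - 1" 1] by simp
  have one: "1 \<le> (1 + v) powr (q - 1)" using q v by (intro ge_one_powr_ge_zero) auto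
  have "v / (1 + v) \<le> R / (1 + R)" using v by (simp add: field_simps)
  then have "(v / (1 + v)) powr (q - 1) \<le> (R / (1 + R)) powr (q - 1)"
    using q v by (intro powr_mono2) auto
  moreover have "(R / (1 + R)) powr (q - 1) \<le> 1" using q v by (intro powr_le1) auto
  ultimately have "1 * (1 - (R / (1 + R)) powr (q - 1)) \<le> (1 + v) powr (q - 1) * (1 - (v / (1 + v)) powr (q - 1))"
    using one by (intro mult_mono) auto
  also have "\<dots> = (1 + v) powr (q - 1) - v powr (q - 1)"
    using v one by (simp add: powr_divide right_diff_distrib)
  finally have "v * (1 - (R / (1 + R)) powr (q - 1)) \<le> v * ((1 + v) powr (q - 1) - v powr (q - 1))"
    using v by (intro mult_left_mono) auto
  also have "\<dots> \<le> (1 + v) powr q - 1 - v powr q"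
    using e[of "1 + v"] e[of v] v one by (simp add: algebra_simps)
  finally show ?thesis .
qed

lemma powr_midpoint_ge:
  fixes q x y :: real
  assumes "1 \<le> q" "0 \<le> x" "0 \<le> y"
  shows "((x + y) / 2) powr q \<le> (x powr q + y powr q) / 2"
  using powr_convex_nonneg[of q x y "1/2" "1/2"] assms by (simp add: add_divide_distrib)

text \<open>
  The case of a spike \<open>|x| \<gg> h\<close>, with \<open>r = h / |x|\<close> and \<open>c\<close> the cosine of the angle. To second
  order in \<open>r\<close> the claim reads \<open>4 q\<^sup>2 c\<^sup>2 \<le> 4 (q + 2 q (q - 1) c\<^sup>2)\<close>, which is strict as
  \<open>1 + (q - 2) c\<^sup>2 \<ge> min 1 (q - 1) > 0\<close>.
\<close>

lemma signed_perturbation_small_ratio: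
  fixes q :: real
  assumes q: "1 < q"
  obtains r0 where "0 < r0"
    "\<And>r c. 0 < r \<Longrightarrow> r \<le> r0 \<Longrightarrow> \<bar>c\<bar> \<le> 1 \<Longrightarrow>
      (((1 + r\<^sup>2 - 2*r*c) powr q - (1 + r\<^sup>2 + 2*r*c) powr q) / 2)\<^sup>2
      \<le> 4 * (((1 + r\<^sup>2 - 2*r*c) powr q + (1 + r\<^sup>2 + 2*r*c) powr q) / 2 - 1 - r powr (2 * q))"
proof -
  \<comment> \<open>In units of \<open>r\<^sup>2\<close> the error terms cost
    \<open>25 * \<epsilon>\<close>: four times the six in \<open>low\<close>, and one in
    \<open>b2\<close>. The main terms can afford this by \<open>key\<close>.\<close>
  define \<epsilon> where "\<epsilon> = 4 * q * min 1 (q - 1) / 25"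
  have \<epsilon>: "0 < \<epsilon>" using q by (simp add: \<epsilon>_def)
  obtain \<eta> where \<eta>: "0 < \<eta>" "\<eta> < 1" and tay: "\<And>y. \<bar>y\<bar> \<le> \<eta> \<Longrightarrow>
    \<bar>(1 + y) powr q - 1 - q * y - q * (q - 1) / 2 * y\<^sup>2\<bar> \<le> \<epsilon> * y\<^sup>2"
    using powr_taylor_second_order[OF \<epsilon>] by blast
  define L where "L = 2 * q * (q - 1) + 5 * \<epsilon>"
  have L: "0 < L" using q \<epsilon> by (simp add: L_def add_pos_pos)
  \<comment> \<open>The three bounds keep \<open>y\<close> and \<open>z\<close> in the range of the
    expansion, make \<open>r powr (2 * q)\<close> at most \<open>\<epsilon> * r\<^sup>2\<close>, and
    absorb the terms with \<open>L\<close> in \<open>b2\<close>.\<close>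
  define r0 where "r0 = min (\<eta> / 3) (min (\<epsilon> powr (1 / (2 * q - 2))) (\<epsilon> / (4 * q * L + L\<^sup>2)))"
  have Lq: "0 < 4 * q * L + L\<^sup>2" using L q by (simp add: add_pos_pos)
  have r0: "0 < r0" using \<eta> \<epsilon> Lq by (simp add: r0_def)
  show thesis
  proof (rule that[OF r0])
    fix r c :: real
    assume r: "0 < r" "r \<le> r0" and c: "\<bar>c\<bar> \<le> 1"
    have r\<eta>: "r \<le> \<eta> / 3" and rp: "r \<le> \<epsilon> powr (1 / (2 * q - 2))" and rL0: "r \<le> \<epsilon> / (4 * q * L + L\<^sup>2)"
      using r unfolding r0_def by linarith+
    have rL: "r * (4 * q * L + L\<^sup>2) \<le> \<epsilon>" using rL0 Lq by (simp add: pos_le_divide_eq)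
    have r1: "r \<le> 1" using r\<eta> \<eta> by simp
    have rr: "r\<^sup>2 \<le> r" using r r1 by (simp add: power2_eq_square mult_left_le)
    have rc: "\<bar>r * c\<bar> \<le> r" using r c by (simp add: abs_mult mult_left_le)
    have c2: "c\<^sup>2 \<le> 1" using c by (simp add: abs_square_le_1)
    have pw: "r powr (2 * q) \<le> \<epsilon> * r\<^sup>2"
    proof -
      have "r powr (2 * q) = r powr (2 * q - 2) * r powr 2" by (simp flip: powr_add)
      moreover have "r powr (2 * q - 2) \<le> (\<epsilon> powr (1 / (2 * q - 2))) powr (2 * q - 2)"
        using rp r q by (intro powr_mono2) auto
      moreover have "(\<epsilon> powr (1 / (2 * q - 2))) powr (2 * q - 2) = \<epsilon>"
        using q \<epsilon> by (simp add: powr_powr)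
      moreover have "r powr 2 = r\<^sup>2" using r powr_realpow[of r 2] by simp
      ultimately show ?thesis by (simp add: mult_right_mono)
    qed
    define y z where "y = r\<^sup>2 - 2*r*c" and "z = r\<^sup>2 + 2*r*c"
    have "\<bar>y\<bar> \<le> \<eta>" "\<bar>z\<bar> \<le> \<eta>" using rr rc r\<eta> zero_le_power2[of r] unfolding y_def z_def by linarith+
    then have ty: "\<bar>(1 + y) powr q - 1 - q * y - q * (q - 1) / 2 * y\<^sup>2\<bar> \<le> \<epsilon> * y\<^sup>2"
      and tz: "\<bar>(1 + z) powr q - 1 - q * z - q * (q - 1) / 2 * z\<^sup>2\<bar> \<le> \<epsilon> * z\<^sup>2"
      by (blast intro: tay)+
    define Y Z where "Y = (1 + y) powr q" and "Z = (1 + z) powr q"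
    have syz: "y\<^sup>2 + z\<^sup>2 = 2 * r^4 + 8 * (r\<^sup>2 * c\<^sup>2)" "y\<^sup>2 - z\<^sup>2 = - 8 * (r^3 * c)"
      "y + z = 2 * r\<^sup>2" "y - z = - 4 * (r * c)"
      by (simp_all add: y_def z_def power2_eq_square power3_eq_cube power4_eq_xxxx algebra_simps)
    have r4: "r^4 \<le> r\<^sup>2" using r r1 by (intro power_decreasing) auto
    have r3: "r^3 \<le> r\<^sup>2" using r r1 by (intro power_decreasing) auto
    have "r\<^sup>2 * c\<^sup>2 \<le> r\<^sup>2" using c2 by (simp add: mult_left_le)
    then have sq: "y\<^sup>2 + z\<^sup>2 \<le> 10 * r\<^sup>2" using syz r4 by linarith
    then have esq: "\<epsilon> * y\<^sup>2 + \<epsilon> * z\<^sup>2 \<le> 10 * (\<epsilon> * r\<^sup>2)"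
      using \<epsilon> mult_left_mono[OF sq, of \<epsilon>] by (simp add: distrib_left)
    have "Y + Z \<ge> 2 + q * (y + z) + q * (q - 1) / 2 * (y\<^sup>2 + z\<^sup>2) - (\<epsilon> * y\<^sup>2 + \<epsilon> * z\<^sup>2)"
      using ty tz unfolding Y_def Z_def distrib_left abs_le_iff by linarith
    moreover have "q * (q - 1) / 2 * (y\<^sup>2 + z\<^sup>2) \<ge> q * (q - 1) / 2 * (8 * (r\<^sup>2 * c\<^sup>2))"
      using q syz r by (intro mult_left_mono) auto
    moreover have "q * (y + z) = 2 * (q * r\<^sup>2)" "q * (q - 1) / 2 * (8 * (r\<^sup>2 * c\<^sup>2)) = 4 * (q * (q - 1) * (r\<^sup>2 * c\<^sup>2))"
      using syz by simp_all
    ultimately have low: "(Y + Z) / 2 - 1 - r powr (2 * q)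
        \<ge> q * r\<^sup>2 + 2 * (q * (q - 1) * (r\<^sup>2 * c\<^sup>2)) - 6 * (\<epsilon> * r\<^sup>2)"
      using esq pw by argo
    have up: "\<bar>(Y - Z) / 2\<bar> \<le> 2 * q * (r * \<bar>c\<bar>) + L * r\<^sup>2"
    proof -
      have "\<bar>Y - Z - q * (y - z) - q * (q - 1) / 2 * (y\<^sup>2 - z\<^sup>2)\<bar> \<le> 10 * (\<epsilon> * r\<^sup>2)"
        using ty tz esq unfolding Y_def Z_def right_diff_distrib abs_le_iff by linarith
      moreover have "q * (y - z) = - 4 * q * (r * c)" using syz by simp
      moreover have "q * (q - 1) / 2 * (y\<^sup>2 - z\<^sup>2) = - 4 * (q * (q - 1)) * (r^3 * c)" using syz by simp
      moreover have "\<bar>4 * q * (r * c)\<bar> = 4 * q * (r * \<bar>c\<bar>)" using q r by (simp add: abs_mult)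
      moreover have "\<bar>4 * (q * (q - 1)) * (r^3 * c)\<bar> \<le> 4 * (q * (q - 1)) * r\<^sup>2"
      proof -
        have "r^3 * \<bar>c\<bar> \<le> r\<^sup>2 * 1" using r3 c r by (intro mult_mono) auto
        then have "4 * (q * (q - 1)) * (r^3 * \<bar>c\<bar>) \<le> 4 * (q * (q - 1)) * (r\<^sup>2 * 1)"
          using q by (intro mult_left_mono) auto
        then show ?thesis using q r by (simp add: abs_mult)
      qed
      ultimately have "\<bar>Y - Z\<bar> \<le> 4 * q * (r * \<bar>c\<bar>) + 4 * (q * (q - 1)) * r\<^sup>2 + 10 * (\<epsilon> * r\<^sup>2)" by linarith
      then show ?thesis by (simp add: L_def algebra_simps)
    qed
    have "((Y - Z) / 2)\<^sup>2 \<le> (2 * q * (r * \<bar>c\<bar>) + L * r\<^sup>2)\<^sup>2"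
      using up by (rule abs_le_square_iff[THEN iffD1, OF order_trans]) simp
    also have "\<dots> = 4 * q\<^sup>2 * (r\<^sup>2 * c\<^sup>2) + r\<^sup>2 * (r * (4 * q * L * \<bar>c\<bar> + r * L\<^sup>2))"
      by (simp add: power2_eq_square algebra_simps abs_mult_self_eq)
    also have "r\<^sup>2 * (r * (4 * q * L * \<bar>c\<bar> + r * L\<^sup>2)) \<le> r\<^sup>2 * (r * (4 * q * L * 1 + 1 * L\<^sup>2))"
      using r r1 c q L by (intro mult_left_mono add_mono mult_right_mono) auto
    also have "\<dots> \<le> r\<^sup>2 * \<epsilon>" using rL by (intro mult_left_mono) auto
    finally have b2: "((Y - Z) / 2)\<^sup>2 \<le> 4 * q\<^sup>2 * (r\<^sup>2 * c\<^sup>2) + r\<^sup>2 * \<epsilon>" by simp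
    have key: "25 * \<epsilon> \<le> 4 * q * (1 + (q - 2) * c\<^sup>2)"
    proof -
      have "min 1 (q - 1) \<le> 1 + (q - 2) * c\<^sup>2"
      proof (cases "q \<ge> 2")
        case False
        then have "(q - 2) * 1 \<le> (q - 2) * c\<^sup>2" using c2 by (intro mult_left_mono_neg) auto
        then show ?thesis by simp
      qed (simp add: min.coboundedI1)
      then have "4 * q * min 1 (q - 1) \<le> 4 * q * (1 + (q - 2) * c\<^sup>2)" using q by (intro mult_left_mono) auto
      then show ?thesis by (simp add: \<epsilon>_def)
    qed
    have "r\<^sup>2 * (25 * \<epsilon>) \<le> r\<^sup>2 * (4 * q * (1 + (q - 2) * c\<^sup>2))" using key by (intro mult_left_mono) auto
    also have "\<dots> = 4 * (q * r\<^sup>2 + 2 * (q * (q - 1) * (r\<^sup>2 * c\<^sup>2))) - 4 * q\<^sup>2 * (r\<^sup>2 * c\<^sup>2)"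
      by (simp add: algebra_simps power2_eq_square)
    finally have "((Y - Z) / 2)\<^sup>2 \<le> 4 * ((Y + Z) / 2 - 1 - r powr (2 * q))"
      using low b2 by argo
    then show "(((1 + r\<^sup>2 - 2*r*c) powr q - (1 + r\<^sup>2 + 2*r*c) powr q) / 2)\<^sup>2
      \<le> 4 * (((1 + r\<^sup>2 - 2*r*c) powr q + (1 + r\<^sup>2 + 2*r*c) powr q) / 2 - 1 - r powr (2 * q))"
      by (simp add: Y_def Z_def y_def z_def add_diff_eq add.assoc)
  qed
qed

section \<open>Even and odd parts of the p-th power of a distance\<close>

definition parallel_diff :: "real \<Rightarrow> 'a::real_normed_vector \<Rightarrow> 'a \<Rightarrow> real" where
  "parallel_diff p u x = (norm (u - x) powr p - norm (u + x) powr p) / 2"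

text \<open>The excess in Clarkson's inequality. Adding \<open>norm u powr p + norm x powr p\<close>
  gives the part of \<open>norm (u - x) powr p\<close> that is even in \<open>u\<close>; the odd
  part is \<open>parallel_diff\<close>, so a change of sign of \<open>u\<close> affects only the
  latter.\<close>

definition parallel_gain :: "real \<Rightarrow> 'a::real_normed_vector \<Rightarrow> 'a \<Rightarrow> real" where
  "parallel_gain p u x = (norm (u - x) powr p + norm (u + x) powr p) / 2 - norm u powr p - norm x powr p"

text \<open>Mean value theorem, with the derivative bounded by its value at
  \<open>K\<close>.\<close>

lemma powr_diff_le:
  fixes x y K q :: real
  assumes q: "1 \<le> q" and "0 \<le> x" "x \<le> K" "0 \<le> y" "y \<le> K"
  shows "\<bar>x powr q - y powr q\<bar> \<le> q * K powr (q - 1) * \<bar>x - y\<bar>"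
proof -
  have *: "b powr q - a powr q \<le> q * K powr (q - 1) * (b - a)" if ab: "0 \<le> a" "a < b" "b \<le> K" for a b
  proof -
    have cont: "continuous_on {a..b} (\<lambda>x. x powr q)"
      using ab q by (intro continuous_on_powr') auto
    have der: "((\<lambda>x. x powr q) has_derivative (\<lambda>h. q * \<xi> powr (q - 1) * h)) (at \<xi>)"
      if "a < \<xi>" "\<xi> < b" for \<xi>
    proof -
      have "((\<lambda>x. x powr q) has_real_derivative q * \<xi> powr (q - 1)) (at \<xi>)"
        using ab that by (auto intro!: derivative_eq_intros)
      then show ?thesis by (simp add: has_field_derivative_def)
    qed
    obtain \<xi> where \<xi>: "a < \<xi>" "\<xi> < b" "b powr q - a powr q = q * \<xi> powr (q - 1) * (b - a)"
      by (rule mvt[OF ab(2) cont der]) auto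
    have "\<xi> powr (q - 1) \<le> K powr (q - 1)" using \<xi> ab q by (intro powr_mono2) auto
    then show ?thesis unfolding \<xi>(3) using ab q by (intro mult_right_mono mult_left_mono) auto
  qed
  show ?thesis
  proof (cases x y rule: linorder_cases)
    case less
    then have "x powr q \<le> y powr q" using assms by (intro powr_mono2) auto
    then show ?thesis using *[of x y] assms less by simp
  next
    case greater
    then have "y powr q \<le> x powr q" using assms by (intro powr_mono2) auto
    then show ?thesis using *[of y x] assms greater by simp
  qed simp
qed

lemma powr_eq_power2_powr: "0 \<le> (x::real) \<Longrightarrow> x powr p = (x\<^sup>2) powr (p / 2)"
  using powr_powr[of x 2 "p / 2"] by simp

text \<open>Squared norms expand through the inner product, so p-th powers are written as powers
  \<open>p / 2\<close> of squares. The scale \<open>t\<close> will be \<open>norm u\<close> or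
  \<open>norm x\<close>.\<close>

lemma norm_add_diff_powr_scaled:
  fixes u x :: "'a::real_inner"
  assumes t: "0 < t"
  shows "norm (u - x) powr p = t powr p * ((norm u / t)\<^sup>2 + (norm x / t)\<^sup>2 - 2 * (u \<bullet> x / t\<^sup>2)) powr (p / 2)"
    and "norm (u + x) powr p = t powr p * ((norm u / t)\<^sup>2 + (norm x / t)\<^sup>2 + 2 * (u \<bullet> x / t\<^sup>2)) powr (p / 2)"
proof -
  have *: "t\<^sup>2 * ((norm u / t)\<^sup>2) = (norm u)\<^sup>2" "t\<^sup>2 * ((norm x / t)\<^sup>2) = (norm x)\<^sup>2"
    "t\<^sup>2 * (2 * (u \<bullet> x / t\<^sup>2)) = 2 * (u \<bullet> x)"
    using t by (simp_all add: power_divide)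
  have 1: "(norm (u - x))\<^sup>2 = t\<^sup>2 * ((norm u / t)\<^sup>2 + (norm x / t)\<^sup>2 - 2 * (u \<bullet> x / t\<^sup>2))"
    unfolding right_diff_distrib distrib_left *
    by (simp add: power2_norm_eq_inner inner_diff inner_commute)
  have 2: "(norm (u + x))\<^sup>2 = t\<^sup>2 * ((norm u / t)\<^sup>2 + (norm x / t)\<^sup>2 + 2 * (u \<bullet> x / t\<^sup>2))"
    unfolding distrib_left * by (simp add: power2_norm_eq_inner inner_add inner_commute)
  have t2: "t powr p = (t\<^sup>2) powr (p / 2)" by (rule powr_eq_power2_powr) (use t in simp)
  show "norm (u - x) powr p = t powr p * ((norm u / t)\<^sup>2 + (norm x / t)\<^sup>2 - 2 * (u \<bullet> x / t\<^sup>2)) powr (p / 2)"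
    unfolding powr_eq_power2_powr[OF norm_ge_zero] 1 t2 by (rule powr_mult)
  show "norm (u + x) powr p = t powr p * ((norm u / t)\<^sup>2 + (norm x / t)\<^sup>2 + 2 * (u \<bullet> x / t\<^sup>2)) powr (p / 2)"
    unfolding powr_eq_power2_powr[OF norm_ge_zero] 2 t2 by (rule powr_mult)
qed

text \<open>Midpoint convexity removes the inner product, as \<open>1 + v - 2 * d\<close> and
  \<open>1 + v + 2 * d\<close> have mean \<open>1 + v\<close>. What remains is the superadditivity
  gap, with \<open>R\<^sup>2\<close> in place of \<open>R\<close>.\<close>

lemma parallel_gain_ge:
  fixes u x :: "'a::real_inner"
  assumes p: "p > 2" and u: "u \<noteq> 0" and R: "norm x / norm u \<le> R"
  shows "norm u powr p * ((norm x / norm u)\<^sup>2 * (1 - (R\<^sup>2 / (1 + R\<^sup>2)) powr (p / 2 - 1))) \<le> parallel_gain p u x"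
proof -
  define v d where "v = (norm x / norm u)\<^sup>2" and "d = u \<bullet> x / (norm u)\<^sup>2"
  have n: "0 < norm u" using u by simp
  have v: "0 \<le> v" "v \<le> R\<^sup>2" using R by (auto simp: v_def intro!: power_mono)
  have e: "norm (u - x) powr p = norm u powr p * (1 + v - 2 * d) powr (p / 2)"
    "norm (u + x) powr p = norm u powr p * (1 + v + 2 * d) powr (p / 2)"
    using norm_add_diff_powr_scaled[OF n, of u x p] n by (simp_all add: v_def d_def)
  have x: "norm x powr p = norm u powr p * v powr (p / 2)"
    using n by (simp add: v_def powr_divide flip: powr_eq_power2_powr)
  have nn: "0 \<le> 1 + v - 2 * d" "0 \<le> 1 + v + 2 * d"
  proof -
    have "\<bar>u \<bullet> x\<bar> / (norm u)\<^sup>2 \<le> norm u * norm x / (norm u)\<^sup>2"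
      by (intro divide_right_mono Cauchy_Schwarz_ineq2) auto
    then have "\<bar>d\<bar> \<le> norm x / norm u" using n by (simp add: d_def power2_eq_square)
    moreover have "2 * (norm x / norm u) \<le> 1 + v"
      using zero_le_power2[of "norm x / norm u - 1"] unfolding power2_diff v_def by simp
    ultimately show "0 \<le> 1 + v - 2 * d" "0 \<le> 1 + v + 2 * d" by linarith+
  qed
  have "v * (1 - (R\<^sup>2 / (1 + R\<^sup>2)) powr (p / 2 - 1)) \<le> (1 + v) powr (p / 2) - 1 - v powr (p / 2)"
    using p v by (intro powr_superadditive_gap) auto
  moreover have "(1 + v) powr (p / 2) \<le> ((1 + v - 2 * d) powr (p / 2) + (1 + v + 2 * d) powr (p / 2)) / 2"
  proof -
    have "((1 + v - 2 * d) + (1 + v + 2 * d)) / 2 = 1 + v" by simp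
    then show ?thesis using powr_midpoint_ge[OF _ nn, of "p / 2"] p by (metis less_divide_eq_numeral1(1) less_imp_le mult_1)
  qed
  ultimately have "v * (1 - (R\<^sup>2 / (1 + R\<^sup>2)) powr (p / 2 - 1)) \<le>
    ((1 + v - 2 * d) powr (p / 2) + (1 + v + 2 * d) powr (p / 2)) / 2 - 1 - v powr (p / 2)" by linarith
  then have "norm u powr p * (v * (1 - (R\<^sup>2 / (1 + R\<^sup>2)) powr (p / 2 - 1))) \<le> norm u powr p *
    (((1 + v - 2 * d) powr (p / 2) + (1 + v + 2 * d) powr (p / 2)) / 2 - 1 - v powr (p / 2))"
    by (rule mult_left_mono) simp
  also have "\<dots> = parallel_gain p u x"
    by (simp add: parallel_gain_def e x algebra_simps add_divide_distrib)
  finally show ?thesis by (simp add: v_def)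
qed

lemma parallel_gain_pos:
  fixes u x :: "'a::real_inner"
  assumes p: "p > 2" and "u \<noteq> 0" "x \<noteq> 0"
  shows "0 < parallel_gain p u x"
proof -
  define s where "s = norm x / norm u"
  have s: "0 < s" using assms by (simp add: s_def)
  have "s\<^sup>2 / (1 + s\<^sup>2) < 1" by (simp add: divide_less_eq add_pos_nonneg)
  then have "(s\<^sup>2 / (1 + s\<^sup>2)) powr (p / 2 - 1) < 1 powr (p / 2 - 1)"
    using p by (intro powr_less_mono2) auto
  then have "0 < norm u powr p * (s\<^sup>2 * (1 - (s\<^sup>2 / (1 + s\<^sup>2)) powr (p / 2 - 1)))"
    using s assms by simp
  also have "\<dots> \<le> parallel_gain p u x"
    using parallel_gain_ge[OF p \<open>u \<noteq> 0\<close>, of x s] by (simp add: s_def)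
  finally show ?thesis .
qed

lemma parallel_gain_nonneg:
  fixes u x :: "'a::real_inner"
  assumes "p > 2"
  shows "0 \<le> parallel_gain p u x"
proof (cases "u = 0 \<or> x = 0")
  case False
  then show ?thesis using parallel_gain_pos[OF assms, of u x] by simp
qed (auto simp: parallel_gain_def)

text \<open>By the triangle inequality it suffices to bound
  \<open>(norm u + norm x) powr p - norm x powr p\<close>. Where
  \<open>norm u \<le> \<tau> * norm x\<close>, the choice of \<open>\<tau>\<close> makes this at
  most \<open>\<eta> * norm x powr p\<close>; elsewhere \<open>norm x\<close> is controlled by
  \<open>norm u\<close>.\<close>

lemma parallel_gain_le:
  fixes p \<eta> :: real
  assumes p: "p > 0" and \<eta>: "\<eta> > 0"
  obtains D where "D \<ge> 0" "\<And>u x :: 'a::real_normed_vector. parallel_gain p u x \<le> D * norm u powr p + \<eta> * norm x powr p"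
proof -
  define \<tau> where "\<tau> = (1 + \<eta>) powr (1 / p) - 1"
  have \<tau>: "0 < \<tau>" using p \<eta> by (simp add: \<tau>_def)
  have \<tau>p: "(1 + \<tau>) powr p = 1 + \<eta>" using p \<eta> by (simp add: \<tau>_def powr_powr)
  show thesis
  proof (rule that[of "(1 + 1 / \<tau>) powr p"])
    fix u x :: 'a
    have "norm (u - x) powr p \<le> (norm u + norm x) powr p" "norm (u + x) powr p \<le> (norm u + norm x) powr p"
      using p by (intro powr_mono2; simp add: norm_triangle_ineq norm_triangle_ineq4)+
    moreover have "0 \<le> norm u powr p" by simp
    ultimately have *: "parallel_gain p u x \<le> (norm u + norm x) powr p - norm x powr p"
      unfolding parallel_gain_def by argo
    show "parallel_gain p u x \<le> (1 + 1 / \<tau>) powr p * norm u powr p + \<eta> * norm x powr p"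
    proof (cases "norm u \<le> \<tau> * norm x")
      case True
      then have "(norm u + norm x) powr p \<le> ((1 + \<tau>) * norm x) powr p"
        using p by (intro powr_mono2) (auto simp: algebra_simps)
      also have "\<dots> = (1 + \<eta>) * norm x powr p" using \<tau> by (simp add: powr_mult \<tau>p)
      finally have "(norm u + norm x) powr p - norm x powr p \<le> \<eta> * norm x powr p"
        by (simp add: distrib_right)
      moreover have "0 \<le> (1 + 1 / \<tau>) powr p * norm u powr p" by simp
      ultimately show ?thesis using * by linarith
    next
      case False
      then have "(norm u + norm x) powr p \<le> ((1 + 1 / \<tau>) * norm u) powr p"
        using p \<tau> by (intro powr_mono2) (auto simp: field_simps)
      also have "\<dots> = (1 + 1 / \<tau>) powr p * norm u powr p" using \<tau> by (simp add: powr_mult)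
      finally have "(norm u + norm x) powr p \<le> (1 + 1 / \<tau>) powr p * norm u powr p" .
      moreover have "0 \<le> \<eta> * norm x powr p" "0 \<le> norm x powr p" using \<eta> by auto
      ultimately show ?thesis using * by linarith
    qed
  qed simp
qed

text \<open>For \<open>norm x / norm u\<close> up to \<open>R\<close>, the difference is at most
  linear and the gain at least quadratic in the ratio, at the price of a large \<open>C\<close>.
  Beyond \<open>R\<close> the small-ratio estimate gives the factor 4, whose size matters:
  \<open>signed_average_gt\<close> relies on \<open>4 * K < 2 * \<theta>\<close>.\<close>

lemma parallel_diff_square_le:
  fixes p :: real
  assumes p: "p > 2"
  obtains C where "C > 0" "\<And>u x :: 'a::real_inner.
    (parallel_diff p u x)\<^sup>2 \<le> parallel_gain p u x * (C * norm u powr p + 4 * norm x powr p)"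
proof -
  define q where "q = p / 2"
  have q: "1 < q" "p = 2 * q" using p by (auto simp: q_def)
  obtain r0 where r0: "0 < r0" and large: "\<And>r c. 0 < r \<Longrightarrow> r \<le> r0 \<Longrightarrow> \<bar>c\<bar> \<le> 1 \<Longrightarrow>
      (((1 + r\<^sup>2 - 2*r*c) powr q - (1 + r\<^sup>2 + 2*r*c) powr q) / 2)\<^sup>2
      \<le> 4 * (((1 + r\<^sup>2 - 2*r*c) powr q + (1 + r\<^sup>2 + 2*r*c) powr q) / 2 - 1 - r powr (2 * q))"
    using signed_perturbation_small_ratio[OF q(1)] by blast
  define R where "R = 1 / r0"
  define \<kappa> where "\<kappa> = 1 - (R\<^sup>2 / (1 + R\<^sup>2)) powr (q - 1)"
  define K where "K = 2 * q * ((1 + R)\<^sup>2) powr (q - 1)"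
  have R: "0 < R" using r0 by (simp add: R_def)
  have \<kappa>: "0 < \<kappa>"
  proof -
    have "R\<^sup>2 / (1 + R\<^sup>2) < 1" by (simp add: divide_less_eq add_pos_nonneg)
    then have "(R\<^sup>2 / (1 + R\<^sup>2)) powr (q - 1) < 1 powr (q - 1)"
      using q by (intro powr_less_mono2) auto
    then show ?thesis by (simp add: \<kappa>_def)
  qed
  have K: "0 < K" using q R by (simp add: K_def)
  show thesis
  proof (rule that[of "K\<^sup>2 / \<kappa>"])
    show "0 < K\<^sup>2 / \<kappa>" using K \<kappa> by simp
    fix u x :: 'a
    have g0: "0 \<le> parallel_gain p u x" by (rule parallel_gain_nonneg[OF p])
    have CS: "\<bar>u \<bullet> x\<bar> \<le> norm u * norm x" by (rule Cauchy_Schwarz_ineq2)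
    consider "u = 0" | "u \<noteq> 0" "norm x / norm u \<le> R" | "u \<noteq> 0" "norm x / norm u > R" by linarith
    then show "(parallel_diff p u x)\<^sup>2 \<le> parallel_gain p u x * (K\<^sup>2 / \<kappa> * norm u powr p + 4 * norm x powr p)"
    proof cases
      case 1
      then show ?thesis by (simp add: parallel_diff_def parallel_gain_def)
    next
      case 2
      define s d where "s = norm x / norm u" and "d = u \<bullet> x / (norm u)\<^sup>2"
      have n: "0 < norm u" using 2 by simp
      have s: "0 \<le> s" "s \<le> R" using 2 by (auto simp: s_def)
      have e: "norm (u - x) powr p = norm u powr p * (1 + s\<^sup>2 - 2 * d) powr q"
        "norm (u + x) powr p = norm u powr p * (1 + s\<^sup>2 + 2 * d) powr q"
        using norm_add_diff_powr_scaled[OF n, of u x p] n by (simp_all add: s_def d_def q_def)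
      have "\<bar>u \<bullet> x\<bar> / (norm u)\<^sup>2 \<le> norm u * norm x / (norm u)\<^sup>2"
        by (intro divide_right_mono CS) auto
      then have d: "\<bar>d\<bar> \<le> s" using n by (simp add: d_def s_def power2_eq_square)
      have s2: "2 * s \<le> 1 + s\<^sup>2" using zero_le_power2[of "s - 1"] unfolding power2_diff by simp
      have sR: "1 + s\<^sup>2 + 2 * s \<le> (1 + R)\<^sup>2"
        using power_mono[of "1 + s" "1 + R" 2] s by (simp add: power2_sum)
      have "\<bar>(1 + s\<^sup>2 - 2 * d) powr q - (1 + s\<^sup>2 + 2 * d) powr q\<bar>
          \<le> q * ((1 + R)\<^sup>2) powr (q - 1) * \<bar>(1 + s\<^sup>2 - 2 * d) - (1 + s\<^sup>2 + 2 * d)\<bar>"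
        by (rule powr_diff_le) (use q d s2 sR in linarith)+
      also have "(1 + s\<^sup>2 - 2 * d) - (1 + s\<^sup>2 + 2 * d) = - 4 * d" by simp
      also have "q * ((1 + R)\<^sup>2) powr (q - 1) * \<bar>- 4 * d\<bar> = 2 * (K * \<bar>d\<bar>)"
        by (simp add: K_def abs_mult)
      also have "\<dots> \<le> 2 * (K * s)" using d K by simp
      finally have "\<bar>((1 + s\<^sup>2 - 2 * d) powr q - (1 + s\<^sup>2 + 2 * d) powr q) / 2\<bar> \<le> K * s" by simp
      then have "norm u powr p * \<bar>((1 + s\<^sup>2 - 2 * d) powr q - (1 + s\<^sup>2 + 2 * d) powr q) / 2\<bar> \<le> norm u powr p * (K * s)"
        by (rule mult_left_mono) simp
      moreover have "parallel_diff p u x = norm u powr p * (((1 + s\<^sup>2 - 2 * d) powr q - (1 + s\<^sup>2 + 2 * d) powr q) / 2)"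
        by (simp add: parallel_diff_def e right_diff_distrib)
      ultimately have "\<bar>parallel_diff p u x\<bar> \<le> norm u powr p * (K * s)"
        by (simp only: abs_mult abs_of_nonneg[OF powr_ge_zero])
      then have "\<bar>parallel_diff p u x\<bar>\<^sup>2 \<le> (norm u powr p * (K * s))\<^sup>2" by (rule power_mono) simp
      also have "\<dots> = norm u powr p * (s\<^sup>2 * \<kappa>) * (K\<^sup>2 / \<kappa> * norm u powr p)"
        using \<kappa> by (simp add: power2_eq_square)
      also have "\<dots> \<le> parallel_gain p u x * (K\<^sup>2 / \<kappa> * norm u powr p)"
        using parallel_gain_ge[OF p 2] \<kappa> by (intro mult_right_mono) (auto simp: \<kappa>_def q_def s_def)
      also have "\<dots> \<le> parallel_gain p u x * (K\<^sup>2 / \<kappa> * norm u powr p + 4 * norm x powr p)"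
        using g0 by (intro mult_left_mono) auto
      finally show ?thesis by simp
    next
      case 3
      define r c where "r = norm u / norm x" and "c = u \<bullet> x / (norm u * norm x)"
      have n: "0 < norm u" "0 < norm x" using 3 R by (auto intro!: ccontr[of "0 < norm x"])
      have r: "0 < r" "r \<le> r0" using 3 n r0 by (auto simp: r_def R_def field_simps)
      have c: "\<bar>c\<bar> \<le> 1" using CS n by (simp add: c_def abs_mult divide_le_eq)
      have rc: "u \<bullet> x / (norm x)\<^sup>2 = r * c" using n by (simp add: r_def c_def power2_eq_square)
      have e: "norm (u - x) powr p = norm x powr p * (1 + r\<^sup>2 - 2 * r * c) powr q"
        "norm (u + x) powr p = norm x powr p * (1 + r\<^sup>2 + 2 * r * c) powr q"
        using norm_add_diff_powr_scaled[OF n(2), of u x p] n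
        by (simp_all add: rc q_def mult.assoc add.commute flip: r_def)
      have u: "norm u powr p = norm x powr p * r powr (2 * q)"
        using n by (simp add: r_def powr_divide q)
      have "(parallel_diff p u x)\<^sup>2 = (norm x powr p)\<^sup>2 * (((1 + r\<^sup>2 - 2*r*c) powr q - (1 + r\<^sup>2 + 2*r*c) powr q) / 2)\<^sup>2"
        unfolding power_mult_distrib[symmetric] parallel_diff_def e by (simp add: right_diff_distrib)
      also have "\<dots> \<le> (norm x powr p)\<^sup>2 * (4 * (((1 + r\<^sup>2 - 2*r*c) powr q + (1 + r\<^sup>2 + 2*r*c) powr q) / 2 - 1 - r powr (2 * q)))"
        using large[OF r c] by (rule mult_left_mono) simp
      also have "\<dots> = parallel_gain p u x * (4 * norm x powr p)"
        by (simp add: parallel_gain_def e u power2_eq_square algebra_simps add_divide_distrib)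
      also have "\<dots> \<le> parallel_gain p u x * (K\<^sup>2 / \<kappa> * norm u powr p + 4 * norm x powr p)"
        using g0 \<kappa> by (intro mult_left_mono) auto
      finally show ?thesis .
    qed
  qed
qed

section \<open>Rendezvous numbers of the unit sphere\<close>

text \<open>Frees the averages from the index range \<open>{1..n}\<close>; the index sets will be
  \<open>{..<n}\<close> and \<open>Pow {..<n}\<close>.\<close>

lemma rendezvous_number_finite_family:
  assumes r: "rendezvous_number M d r" and I: "finite I" "I \<noteq> {}" and xs: "\<And>i. i \<in> I \<Longrightarrow> xs i \<in> M"
  obtains x where "x \<in> M" "(\<Sum>i\<in>I. d (xs i) x) = real (card I) * r"
proof -
  obtain h where h: "bij_betw h {1..card I} I"
    using ex_bij_betw_nat_finite_1[OF I(1)] by blast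
  have c: "1 \<le> card I" using I by (simp add: Suc_le_eq card_gt_0_iff)
  have "\<forall>k\<in>{1..card I}. (xs \<circ> h) k \<in> M" using xs bij_betwE[OF h] by auto
  then obtain x where x: "x \<in> M" "(1 / real (card I)) * (\<Sum>k=1..card I. d ((xs \<circ> h) k) x) = r"
    using r c unfolding rendezvous_number_def by blast
  have "(\<Sum>k=1..card I. d ((xs \<circ> h) k) x) = (\<Sum>i\<in>I. d (xs i) x)"
    using sum.reindex_bij_betw[OF h, of "\<lambda>i. d (xs i) x"] by simp
  then show thesis using x c by (intro that[of x]) (auto simp: field_simps)
qed

text \<open>Distances, hence averages, are transported along \<open>\<phi>\<close>, and surjectivity
  brings the point found in \<open>M'\<close> back to \<open>M\<close>. This allows representatives
  in place of classes.\<close>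

lemma rendezvous_number_pullback:
  assumes r: "rendezvous_number M' d' r" and maps: "\<And>x. x \<in> M \<Longrightarrow> \<phi> x \<in> M'"
    and onto: "\<And>y. y \<in> M' \<Longrightarrow> \<exists>x\<in>M. y = \<phi> x"
    and iso: "\<And>x y. x \<in> M \<Longrightarrow> y \<in> M \<Longrightarrow> d' (\<phi> x) (\<phi> y) = d x y"
  shows "rendezvous_number M d r"
  unfolding rendezvous_number_def
proof (intro allI impI)
  fix n :: nat and xs assume n: "1 \<le> n" and xs: "\<forall>k\<in>{1..n}. xs k \<in> M"
  then have "\<forall>k\<in>{1..n}. (\<phi> \<circ> xs) k \<in> M'" using maps by auto
  then obtain y where y: "y \<in> M'" "(1 / real n) * (\<Sum>k=1..n. d' ((\<phi> \<circ> xs) k) y) = r"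
    using r n unfolding rendezvous_number_def by blast
  obtain x where x: "x \<in> M" "y = \<phi> x" using onto y by blast
  have "(\<Sum>k=1..n. d' ((\<phi> \<circ> xs) k) y) = (\<Sum>k=1..n. d (xs k) x)"
    using xs x iso by (intro sum.cong) auto
  then show "\<exists>x\<in>M. (1 / real n) * (\<Sum>k=1..n. d (xs k) x) = r" using x y by auto
qed

section \<open>Integrals over the blocks of a partition\<close>

definition block_integral :: "'b measure \<Rightarrow> ('b \<Rightarrow> nat) \<Rightarrow> nat \<Rightarrow> ('b \<Rightarrow> real) \<Rightarrow> real" where
  "block_integral M \<beta> j f = (LINT t|M. indicator {j} (\<beta> t) * f t)"

lemma borel_measurable_block_indicator [measurable (raw)]:
  "\<beta> \<in> measurable M (count_space UNIV) \<Longrightarrow> (\<lambda>t. indicator {j} (\<beta> t) :: real) \<in> borel_measurable M"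
  by (rule measurable_compose[where N = "count_space UNIV"]) auto

lemma integrable_block:
  fixes f :: "'b \<Rightarrow> real"
  assumes [measurable]: "\<beta> \<in> measurable M (count_space UNIV)" and f: "integrable M f"
  shows "integrable M (\<lambda>t. indicator {j} (\<beta> t) * f t)"
proof (rule Bochner_Integration.integrable_bound[OF f])
  have [measurable]: "f \<in> borel_measurable M" using f by simp
  show "(\<lambda>t. indicator {j} (\<beta> t) * f t) \<in> borel_measurable M" by measurable
qed (auto simp: indicator_def)

lemma sum_block_integral:
  assumes \<beta>: "\<beta> \<in> measurable M (count_space UNIV)" "\<And>t. t \<in> space M \<Longrightarrow> \<beta> t < n" and f: "integrable M f"
  shows "(\<Sum>j<n. block_integral M \<beta> j f) = (LINT t|M. f t)"
proof -
  have "(\<Sum>j<n. block_integral M \<beta> j f) = (LINT t|M. (\<Sum>j<n. indicator {j} (\<beta> t) * f t))"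
    unfolding block_integral_def by (rule Bochner_Integration.integral_sum[symmetric]) (rule integrable_block[OF \<beta>(1) f])
  also have "\<dots> = (LINT t|M. f t)"
  proof (rule Bochner_Integration.integral_cong)
    fix t assume "t \<in> space M"
    then have "\<beta> t \<in> {..<n}" using \<beta> by simp
    moreover have "(\<Sum>j<n. indicator {j} (\<beta> t) * f t) = (\<Sum>j\<in>{..<n}. if j = \<beta> t then f t else 0)"
      by (intro sum.cong) (auto simp: indicator_def)
    ultimately show "(\<Sum>j<n. indicator {j} (\<beta> t) * f t) = f t" by simp
  qed simp
  finally show ?thesis .
qed

lemma block_integral_mono:
  assumes \<beta>: "\<beta> \<in> measurable M (count_space UNIV)" and "integrable M f" "integrable M g"
    and le: "\<And>t. t \<in> space M \<Longrightarrow> f t \<le> g t"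
  shows "block_integral M \<beta> j f \<le> block_integral M \<beta> j g"
  unfolding block_integral_def
  using assms by (intro integral_mono integrable_block[OF \<beta>]) (auto simp: indicator_def)

lemma block_integral_nonneg: "(\<And>t. 0 \<le> f t) \<Longrightarrow> 0 \<le> block_integral M \<beta> j f"
  unfolding block_integral_def by (intro Bochner_Integration.integral_nonneg) auto

lemma block_integral_linear:
  assumes \<beta>: "\<beta> \<in> measurable M (count_space UNIV)" and f: "integrable M f" and g: "integrable M g"
  shows "block_integral M \<beta> j (\<lambda>t. a * f t + b * g t) = a * block_integral M \<beta> j f + b * block_integral M \<beta> j g"
proof -
  have "block_integral M \<beta> j (\<lambda>t. a * f t + b * g t)
      = (LINT t|M. a * (indicator {j} (\<beta> t) * f t) + b * (indicator {j} (\<beta> t) * g t))"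
    unfolding block_integral_def by (intro Bochner_Integration.integral_cong) (auto simp: algebra_simps)
  also have "\<dots> = a * block_integral M \<beta> j f + b * block_integral M \<beta> j g"
    using integrable_block[OF \<beta> f] integrable_block[OF \<beta> g] by (simp add: block_integral_def)
  finally show ?thesis .
qed

lemma block_integral_abs_le:
  assumes \<beta>: "\<beta> \<in> measurable M (count_space UNIV)" and f: "integrable M f"
  shows "\<bar>block_integral M \<beta> j f\<bar> \<le> block_integral M \<beta> j (\<lambda>t. \<bar>f t\<bar>)"
proof -
  have "\<bar>block_integral M \<beta> j f\<bar> \<le> (LINT t|M. \<bar>indicator {j} (\<beta> t) * f t\<bar>)"
    unfolding block_integral_def by (rule integral_abs_bound)
  then show ?thesis by (simp add: block_integral_def abs_mult)
qed

text \<open>The function \<open>\<beta>\<close> assigns to each point the index of its block.\<close>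

definition block_weight :: "real \<Rightarrow> 'b measure \<Rightarrow> nat \<Rightarrow> ('b \<Rightarrow> real) \<Rightarrow> ('b \<Rightarrow> nat) \<Rightarrow> bool" where
  "block_weight p M n h \<beta> \<longleftrightarrow>
     h \<in> borel_measurable M \<and> (\<forall>t. 0 < h t) \<and> integrable M (\<lambda>t. h t powr p) \<and>
     \<beta> \<in> measurable M (count_space UNIV) \<and> (\<forall>t\<in>space M. \<beta> t < n) \<and>
     (\<forall>j<n. block_integral M \<beta> j (\<lambda>t. h t powr p) = 1 / real n)"

text \<open>Consists of functions, not of classes, so that counting measure covers the sequence
  space in the same setting.\<close>

definition Lp_sphere :: "real \<Rightarrow> 'b measure \<Rightarrow> ('b \<Rightarrow> 'a::{banach,second_countable_topology}) set" where
  "Lp_sphere p M = {f \<in> Lp_fun p M. Lp_seminorm p M f = 1}"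

lemma Lp_seminorm_eq_1_iff:
  assumes "p > 0"
  shows "Lp_seminorm p M f = 1 \<longleftrightarrow> (LINT t|M. norm (f t) powr p) = 1"
proof -
  have "0 \<le> (LINT t|M. norm (f t) powr p)" by (intro Bochner_Integration.integral_nonneg) simp
  then have "(LINT t|M. norm (f t) powr p) = Lp_seminorm p M f powr p"
    using assms by (simp add: Lp_seminorm_def powr_powr)
  then show ?thesis by (auto simp: Lp_seminorm_def)
qed

section \<open>Upper bound from disjointly supported vectors\<close>

text \<open>A linear substitute for Hoelder's inequality: the roots of \<open>n\<close> masses with
  sum 1 add up to at most \<open>n * \<tau> + 1 / \<tau> powr p\<close>, so their average is small
  for large \<open>n\<close>.\<close>

lemma powr_inverse_le_add:
  fixes m \<tau> p :: real
  assumes "0 < p" "0 < \<tau>" "0 \<le> m" "m \<le> 1"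
  shows "m powr (1 / p) \<le> \<tau> + m / \<tau> powr p"
proof (cases "m \<le> \<tau> powr p")
  case True
  then have "m powr (1 / p) \<le> (\<tau> powr p) powr (1 / p)" using assms by (intro powr_mono2) auto
  also have "\<dots> = \<tau>" using assms by (simp add: powr_powr)
  finally show ?thesis using assms by (simp add: add_increasing2)
next
  case False
  then have "1 \<le> m / \<tau> powr p" using assms by simp
  moreover have "m powr (1 / p) \<le> 1" using assms by (intro powr_le1) auto
  ultimately show ?thesis using assms by linarith
qed

text \<open>The factor \<open>real n powr (1 / p)\<close> makes up for the block mass
  \<open>1 / real n\<close>.\<close>

definition block_vector :: "real \<Rightarrow> nat \<Rightarrow> ('b \<Rightarrow> real) \<Rightarrow> ('b \<Rightarrow> nat) \<Rightarrow> 'a::real_vector \<Rightarrow> nat \<Rightarrow> 'b \<Rightarrow> 'a" where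
  "block_vector p n h \<beta> e k t = (real n powr (1 / p) * h t * indicator {k} (\<beta> t)) *\<^sub>R e"

lemma norm_block_vector:
  fixes e :: "'a::real_normed_vector"
  assumes "p > 0" "norm e = 1" "\<And>t. 0 < h t"
  shows "norm (block_vector p n h \<beta> e k t) powr p = real n * (indicator {k} (\<beta> t) * h t powr p)"
  using assms(1,2) assms(3)[of t] by (auto simp: block_vector_def indicator_def powr_mult powr_powr)

lemma block_vector_in_Lp_sphere:
  fixes e :: "'a::{banach,second_countable_topology}"
  assumes p: "p > 0" and bw: "block_weight p M n h \<beta>" and e: "norm e = 1" and k: "k < n"
  shows "block_vector p n h \<beta> e k \<in> Lp_sphere p M"
proof -
  have [measurable]: "h \<in> borel_measurable M" "\<beta> \<in> measurable M (count_space UNIV)"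
    and h0: "\<And>t. 0 < h t" and hI: "integrable M (\<lambda>t. h t powr p)"
    and hk: "block_integral M \<beta> k (\<lambda>t. h t powr p) = 1 / real n"
    using bw k by (auto simp: block_weight_def)
  have \<beta>: "\<beta> \<in> measurable M (count_space UNIV)" by measurable
  note nf = norm_block_vector[OF p e h0]
  have "integrable M (\<lambda>t. norm (block_vector p n h \<beta> e k t) powr p)"
    unfolding nf by (intro integrable_mult_right integrable_block[OF \<beta> hI])
  moreover have "(LINT t|M. norm (block_vector p n h \<beta> e k t) powr p) = 1"
    unfolding nf using hk k by (simp add: block_integral_def)
  moreover have "block_vector p n h \<beta> e k \<in> borel_measurable M" unfolding block_vector_def by measurable
  ultimately show ?thesis
    using p by (simp add: Lp_sphere_def Lp_fun_def Lp_seminorm_eq_1_iff)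
qed

text \<open>Cut \<open>x\<close> into its parts off and on block \<open>k\<close>. The first has
  support disjoint from the block vector, so their difference \<open>y\<close> has p-th power
  integral at most 2; the second, \<open>z\<close>, is added by the triangle inequality.\<close>

lemma Lp_seminorm_block_vector_diff_le:
  fixes x :: "'b \<Rightarrow> 'a::{banach,second_countable_topology}"
  assumes p: "1 \<le> p" and bw: "block_weight p M n h \<beta>" and e: "norm e = 1" and k: "k < n"
    and x: "x \<in> Lp_sphere p M"
  shows "Lp_seminorm p M (\<lambda>t. block_vector p n h \<beta> e k t - x t)
      \<le> 2 powr (1 / p) + (block_integral M \<beta> k (\<lambda>t. norm (x t) powr p)) powr (1 / p)"
proof -
  define f where "f = block_vector p n h \<beta> e k"
  have [measurable]: "\<beta> \<in> measurable M (count_space UNIV)" "x \<in> borel_measurable M"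
    and xI: "integrable M (\<lambda>t. norm (x t) powr p)"
    using bw x by (auto simp: block_weight_def Lp_sphere_def Lp_fun_def)
  have \<beta>: "\<beta> \<in> measurable M (count_space UNIV)" by measurable
  have x1: "(LINT t|M. norm (x t) powr p) = 1"
    using x p by (simp add: Lp_sphere_def Lp_seminorm_eq_1_iff)
  let ?ind = "\<lambda>t. indicator {k} (\<beta> t) :: real"
  have "f \<in> Lp_sphere p M" unfolding f_def using p by (intro block_vector_in_Lp_sphere bw e k) simp
  then have [measurable]: "f \<in> borel_measurable M" and fI: "integrable M (\<lambda>t. norm (f t) powr p)"
    and f1: "(LINT t|M. norm (f t) powr p) = 1"
    using p by (auto simp: Lp_sphere_def Lp_fun_def Lp_seminorm_eq_1_iff)
  define y z where "y = (\<lambda>t. f t - (1 - ?ind t) *\<^sub>R x t)" and "z = (\<lambda>t. ?ind t *\<^sub>R x t)"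
  have ny: "norm (y t) powr p = norm (f t) powr p + (norm (x t) powr p - ?ind t * norm (x t) powr p)" for t
    by (auto simp: y_def f_def block_vector_def indicator_def)
  have nz: "norm (z t) powr p = ?ind t * norm (x t) powr p" for t
    by (auto simp: z_def indicator_def)
  note bI = integrable_block[OF \<beta> xI, of k]
  have y: "y \<in> Lp_fun p M" using fI xI bI unfolding Lp_fun_def mem_Collect_eq ny by (auto simp: y_def)
  have z: "z \<in> Lp_fun p M" using bI unfolding Lp_fun_def mem_Collect_eq nz by (auto simp: z_def)
  have m0: "0 \<le> block_integral M \<beta> k (\<lambda>t. norm (x t) powr p)" by (rule block_integral_nonneg) simp
  have "(LINT t|M. norm (y t) powr p) = 2 - block_integral M \<beta> k (\<lambda>t. norm (x t) powr p)"
    unfolding ny using fI xI bI f1 x1 by (simp add: block_integral_def)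
  then have "Lp_seminorm p M y \<le> 2 powr (1 / p)"
    unfolding Lp_seminorm_def using m0 p
    by (intro powr_mono2 Bochner_Integration.integral_nonneg) auto
  moreover have "Lp_seminorm p M z = (block_integral M \<beta> k (\<lambda>t. norm (x t) powr p)) powr (1 / p)"
    unfolding Lp_seminorm_def nz block_integral_def ..
  moreover have "(\<lambda>t. f t - x t) = (\<lambda>t. y t - z t)" by (auto simp: y_def z_def algebra_simps)
  ultimately show ?thesis
    unfolding f_def[symmetric] using Lp_seminorm_triangle[OF p y z] by simp
qed

lemma rendezvous_number_Lp_sphere_le:
  fixes M :: "'b measure"
  assumes p: "1 \<le> p" and bw: "\<forall>n\<ge>1. \<exists>h \<beta>. block_weight p M n h \<beta>"
    and r: "rendezvous_number (Lp_sphere p M :: ('b \<Rightarrow> 'a::euclidean_space) set)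
      (\<lambda>f g. Lp_seminorm p M (\<lambda>t. f t - g t)) r"
  shows "r \<le> 2 powr (1 / p)"
proof (rule ccontr)
  assume "\<not> r \<le> 2 powr (1 / p)"
  \<comment> \<open>Half of the supposed excess: one \<open>\<tau>\<close> is spent in
    \<open>powr_inverse_le_add\<close>, the other outweighs \<open>1 / \<tau> powr p\<close> divided
    by \<open>n\<close>.\<close>
  define \<tau> where "\<tau> = (r - 2 powr (1 / p)) / 2"
  have \<tau>: "0 < \<tau>" using \<open>\<not> r \<le> 2 powr (1 / p)\<close> by (simp add: \<tau>_def)
  obtain n0 :: nat where "1 / \<tau> powr p / \<tau> < n0" using reals_Archimedean2 by blast
  define n where "n = Suc n0"
  have n: "1 \<le> n" "1 / \<tau> powr p / \<tau> < n" using \<open>1 / \<tau> powr p / \<tau> < n0\<close> by (auto simp: n_def)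
  then have n\<tau>: "1 / \<tau> powr p < n * \<tau>" using \<tau> by (simp only: pos_divide_less_eq)
  obtain h \<beta> where bw': "block_weight p M n h \<beta>" using bw n(1) by blast
  obtain e :: 'a where "e \<in> Basis" using nonempty_Basis by blast
  then have e: "norm e = 1" by simp
  let ?f = "block_vector p n h \<beta> e"
  have p0: "0 < p" using p by simp
  obtain x where x: "x \<in> Lp_sphere p M"
    "(\<Sum>k<n. Lp_seminorm p M (\<lambda>t. ?f k t - x t)) = real n * r"
    by (rule rendezvous_number_finite_family[OF r, of "{..<n}" ?f])
      (use block_vector_in_Lp_sphere[OF p0 bw' e] n in \<open>auto simp: lessThan_empty_iff\<close>)
  define m where "m = (\<lambda>k. block_integral M \<beta> k (\<lambda>t. norm (x t) powr p))"
  have \<beta>: "\<beta> \<in> measurable M (count_space UNIV)" "\<And>t. t \<in> space M \<Longrightarrow> \<beta> t < n"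
    using bw' by (auto simp: block_weight_def)
  have xI: "integrable M (\<lambda>t. norm (x t) powr p)" using x by (auto simp: Lp_sphere_def Lp_fun_def)
  have msum: "(\<Sum>k<n. m k) = 1"
    using sum_block_integral[OF \<beta> xI] x p by (simp add: m_def Lp_sphere_def Lp_seminorm_eq_1_iff)
  have m0: "0 \<le> m k" for k unfolding m_def by (rule block_integral_nonneg) simp
  have m1: "m k \<le> 1" if "k < n" for k
    using member_le_sum[of k "{..<n}" m] that m0 msum by auto
  have "real n * r \<le> (\<Sum>k<n. 2 powr (1 / p) + (\<tau> + m k / \<tau> powr p))"
    unfolding x(2)[symmetric]
  proof (rule sum_mono)
    fix k assume "k \<in> {..<n}"
    then have k: "k < n" by simp
    show "Lp_seminorm p M (\<lambda>t. ?f k t - x t) \<le> 2 powr (1 / p) + (\<tau> + m k / \<tau> powr p)"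
      using Lp_seminorm_block_vector_diff_le[OF p bw' e k x(1)] powr_inverse_le_add[of p \<tau> "m k"] p \<tau> m0[of k] m1[OF k]
      unfolding m_def by simp
  qed
  also have "\<dots> = n * 2 powr (1 / p) + n * \<tau> + 1 / \<tau> powr p"
    by (simp add: sum.distrib msum flip: sum_divide_distrib)
  also have "\<dots> < n * 2 powr (1 / p) + n * \<tau> + n * \<tau>" by (intro add_strict_left_mono n\<tau>)
  also have "\<dots> = real n * r" by (simp add: \<tau>_def field_simps)
  finally show False by simp
qed

section \<open>Lower bound from vectors with random signs\<close>

text \<open>The p-th power of the distance from \<open>f S\<close> to \<open>x\<close> is affine in
  the block signs, which brings it under \<open>signed_average_gt\<close>. The class
  \<open>euclidean_space\<close> covers real and complex scalars and supplies the inner product of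
  the pointwise estimates.\<close>

lemma signed_block_vector_average_gt:
  fixes M :: "'b measure" and e :: "'a::euclidean_space"
  assumes p: "p > 2" and bw: "\<forall>n\<ge>1. \<exists>h \<beta>. block_weight p M n h \<beta>" and e: "norm e = 1"
  obtains n and f :: "nat set \<Rightarrow> 'b \<Rightarrow> 'a" where "\<forall>S. f S \<in> Lp_sphere p M"
    "\<forall>x\<in>Lp_sphere p M. 2 ^ n * 2 powr (1 / p) < (\<Sum>S\<in>Pow {..<n}. Lp_seminorm p M (\<lambda>t. f S t - x t))"
proof -
  have p0: "0 < p" "1 \<le> p" using p by auto
  obtain C where C: "C > 0" "\<And>u x :: 'a.
      (parallel_diff p u x)\<^sup>2 \<le> parallel_gain p u x * (C * norm u powr p + 4 * norm x powr p)"
    using parallel_diff_square_le[OF p] by blast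
  define P where "P \<eta> D \<longleftrightarrow> 0 \<le> D \<and> (\<forall>u x :: 'a. parallel_gain p u x \<le> D * norm u powr p + \<eta> * norm x powr p)"
    for \<eta> D
  \<comment> \<open>\<open>parallel_gain_le\<close> gives a constant for each \<open>\<eta>\<close>
    separately; \<open>signed_average_gt\<close> takes them as one function, before \<open>n\<close>
    is chosen.\<close>
  define D where "D \<eta> = (SOME D. P \<eta> D)" for \<eta>
  have PD: "P \<eta> (D \<eta>)" if "\<eta> > 0" for \<eta>
  proof -
    have "\<exists>D. P \<eta> D"
      unfolding P_def by (rule parallel_gain_le[OF p0(1) that, where 'a = 'a]) blast
    then show ?thesis unfolding D_def by (rule someI_ex)
  qed
  then have D: "\<forall>\<eta>>0. D \<eta> \<ge> 0"
    "\<And>\<eta> u x. \<eta> > 0 \<Longrightarrow> parallel_gain p (u :: 'a) x \<le> D \<eta> * norm u powr p + \<eta> * norm x powr p"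
    by (simp_all add: P_def)
  obtain n where n: "n \<ge> 1" and avg: "\<forall>b g m. block_estimates C D n b g m \<longrightarrow>
      2 ^ n * 2 powr (1 / p) < (\<Sum>S\<in>Pow {..<n}. (2 + (\<Sum>j<n. g j) + signed_sum {..<n} b S) powr (1 / p))"
    using signed_average_gt[OF p C(1) D(1)] by blast
  obtain h \<beta> where bw': "block_weight p M n h \<beta>" using bw n by blast
  then have [measurable]: "h \<in> borel_measurable M" "\<beta> \<in> measurable M (count_space UNIV)"
    and h0: "\<And>t. 0 < h t" and hI: "integrable M (\<lambda>t. h t powr p)"
    and hj: "\<And>j. j < n \<Longrightarrow> block_integral M \<beta> j (\<lambda>t. h t powr p) = 1 / real n"
    and \<beta>n: "\<And>t. t \<in> space M \<Longrightarrow> \<beta> t < n"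
    by (auto simp: block_weight_def)
  have \<beta>: "\<beta> \<in> measurable M (count_space UNIV)" by measurable
  have h1: "(LINT t|M. h t powr p) = 1"
    using sum_block_integral[OF \<beta> \<beta>n hI] hj n by simp
  define u where "u = (\<lambda>t. h t *\<^sub>R e)"
  have nu: "norm (u t) = h t" for t using h0[of t] e by (simp add: u_def)
  define f where "f = (\<lambda>S t. (if \<beta> t \<in> S then h t else - h t) *\<^sub>R e)"
  have fu: "f S t = (if \<beta> t \<in> S then u t else - u t)" for S t by (simp add: f_def u_def)
  have [measurable]: "u \<in> borel_measurable M" unfolding u_def by measurable
  have fmeas [measurable]: "f S \<in> borel_measurable M" for S
  proof -
    have "(\<lambda>t. if \<beta> t \<in> S then 1 else - 1 :: real) \<in> borel_measurable M"
      by (rule measurable_compose[OF \<beta>]) simp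
    then have "(\<lambda>t. (if \<beta> t \<in> S then 1 else - 1 :: real) *\<^sub>R u t) \<in> borel_measurable M" by measurable
    moreover have "(\<lambda>t. (if \<beta> t \<in> S then 1 else - 1 :: real) *\<^sub>R u t) = f S" by (auto simp: fu)
    ultimately show ?thesis by simp
  qed
  have nf: "norm (f S t) = h t" for S t by (simp add: fu nu)
  have fS: "f S \<in> Lp_sphere p M" for S
    using hI h1 p0 fmeas[of S] by (simp add: Lp_sphere_def Lp_fun_def Lp_seminorm_eq_1_iff nf)
  have uL: "u \<in> Lp_fun p M" "(\<lambda>t. - u t) \<in> Lp_fun p M" using hI by (simp_all add: Lp_fun_def nu)
  have gt: "2 ^ n * 2 powr (1 / p) < (\<Sum>S\<in>Pow {..<n}. Lp_seminorm p M (\<lambda>t. f S t - x t))"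
    if x: "x \<in> Lp_sphere p M" for x
  proof -
    have [measurable]: "x \<in> borel_measurable M" and xL: "x \<in> Lp_fun p M"
      and xI: "integrable M (\<lambda>t. norm (x t) powr p)" and x1: "(LINT t|M. norm (x t) powr p) = 1"
      using x p0 by (auto simp: Lp_sphere_def Lp_fun_def Lp_seminorm_eq_1_iff)
    have I1: "integrable M (\<lambda>t. norm (u t - x t) powr p)"
      using Lp_fun_diff[OF p0(2) uL(1) xL] by (simp add: Lp_fun_def)
    have I2: "integrable M (\<lambda>t. norm (u t + x t) powr p)"
      using Lp_fun_diff[OF p0(2) uL(2) xL] by (simp add: Lp_fun_def norm_minus_commute[of "- _"] add.commute)
    define G B where "G = (\<lambda>t. parallel_gain p (u t) (x t))" and "B = (\<lambda>t. parallel_diff p (u t) (x t))"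
    have GI: "integrable M G" unfolding G_def parallel_gain_def using I1 I2 hI xI by (simp add: nu)
    have BI: "integrable M B" unfolding B_def parallel_diff_def using I1 I2 by simp
    have G0: "0 \<le> G t" for t unfolding G_def by (rule parallel_gain_nonneg[OF p])
    define g b m where "g = (\<lambda>j. block_integral M \<beta> j G)" and "b = (\<lambda>j. block_integral M \<beta> j B)"
      and "m = (\<lambda>j. block_integral M \<beta> j (\<lambda>t. norm (x t) powr p))"
    have gsum: "(\<Sum>j<n. g j) = (LINT t|M. G t)" unfolding g_def by (rule sum_block_integral[OF \<beta> \<beta>n GI])
    have W: "(LINT t|M. norm (f S t - x t) powr p) = 2 + (\<Sum>j<n. g j) + signed_sum {..<n} b S" for S
    proof -
      have "(LINT t|M. norm (f S t - x t) powr p) = (LINT t|M. (h t powr p + norm (x t) powr p + G t)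
          + (\<Sum>j<n. (if j \<in> S then 1 else - 1) * (indicator {j} (\<beta> t) * B t)))"
      proof (rule Bochner_Integration.integral_cong)
        fix t assume "t \<in> space M"
        then have j: "\<beta> t \<in> {..<n}" using \<beta>n by simp
        \<comment> \<open>Only the index \<open>j = \<beta> t\<close> of the block containing
          \<open>t\<close> contributes.\<close>
        have "(\<Sum>j<n. (if j \<in> S then 1 else - 1) * (indicator {j} (\<beta> t) * B t))
            = (\<Sum>j\<in>{..<n}. if j = \<beta> t then (if \<beta> t \<in> S then B t else - B t) else 0)"
          by (intro sum.cong) (auto simp: indicator_def)
        also have "\<dots> = (if \<beta> t \<in> S then B t else - B t)" using j by simp
        finally show "norm (f S t - x t) powr p = (h t powr p + norm (x t) powr p + G t)
          + (\<Sum>j<n. (if j \<in> S then 1 else - 1) * (indicator {j} (\<beta> t) * B t))"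
          using norm_minus_cancel[of "u t + x t"]
          by (simp add: fu G_def B_def parallel_gain_def parallel_diff_def nu field_simps)
      qed simp
      also have "\<dots> = 2 + (LINT t|M. G t) + (\<Sum>j<n. (if j \<in> S then 1 else - 1) * b j)"
        using hI xI GI h1 x1 integrable_block[OF \<beta> BI]
        by (simp add: b_def block_integral_def Bochner_Integration.integral_sum)
      also have "(\<Sum>j<n. (if j \<in> S then 1 else - 1) * b j) = signed_sum {..<n} b S"
        unfolding signed_sum_def by (intro sum.cong) auto
      finally show ?thesis by (simp only: gsum)
    qed
    have m0: "0 \<le> m j" for j unfolding m_def by (rule block_integral_nonneg) simp
    have g0: "0 \<le> g j" for j unfolding g_def by (rule block_integral_nonneg) (rule G0)
    have gpos: "0 < (\<Sum>j<n. g j)"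
    proof -
      \<comment> \<open>As \<open>h\<close> is positive everywhere, a gain vanishing almost
        everywhere would force \<open>x\<close> to vanish almost everywhere.\<close>
      have "(LINT t|M. G t) \<noteq> 0"
      proof
        assume "(LINT t|M. G t) = 0"
        then have "AE t in M. G t = 0" using integral_nonneg_eq_0_iff_AE[OF GI] G0 by simp
        then have "AE t in M. norm (x t) powr p = 0"
        proof eventually_elim
          case (elim t)
          have "u t \<noteq> 0" using nu[of t] h0[of t] by auto
          then show ?case using elim parallel_gain_pos[OF p, of "u t" "x t"] by (auto simp: G_def)
        qed
        then have "(LINT t|M. norm (x t) powr p) = 0" by (rule integral_eq_zero_AE)
        then show False using x1 by simp
      qed
      moreover have "0 \<le> (LINT t|M. G t)" by (intro Bochner_Integration.integral_nonneg G0)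
      ultimately show ?thesis unfolding gsum by simp
    qed
    \<comment> \<open>The pointwise square bound is linearised, integrated over the block for fixed
      \<open>c\<close>, and then turned back into a square bound.\<close>
    have bsq: "(b j)\<^sup>2 \<le> g j * (C / n + 4 * m j)" if j: "j < n" for j
    proof (rule square_le_mult_of_forall_weighted_sum)
      show "0 \<le> g j" by (rule g0)
      show "0 < C / n + 4 * m j" using C n m0[of j] by (intro add_pos_nonneg) auto
      fix c :: real assume c: "0 < c"
      have KI: "integrable M (\<lambda>t. C * h t powr p + 4 * norm (x t) powr p)" using hI xI by simp
      have "\<bar>b j\<bar> \<le> block_integral M \<beta> j (\<lambda>t. \<bar>B t\<bar>)" unfolding b_def by (rule block_integral_abs_le[OF \<beta> BI])
      also have "\<dots> \<le> block_integral M \<beta> j (\<lambda>t. c / 2 * G t + 1 / (2 * c) * (C * h t powr p + 4 * norm (x t) powr p))"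
      proof (rule block_integral_mono[OF \<beta>])
        show "integrable M (\<lambda>t. \<bar>B t\<bar>)" using BI by simp
        show "integrable M (\<lambda>t. c / 2 * G t + 1 / (2 * c) * (C * h t powr p + 4 * norm (x t) powr p))"
          by (intro Bochner_Integration.integrable_add integrable_mult_right GI KI)
        fix t
        have "2 * \<bar>B t\<bar> \<le> c * G t + (C * h t powr p + 4 * norm (x t) powr p) / c"
          using C(2)[of "u t" "x t"] C(1) G0[of t] c
          by (intro double_abs_le_of_square_le_mult) (auto simp: B_def G_def nu)
        then show "\<bar>B t\<bar> \<le> c / 2 * G t + 1 / (2 * c) * (C * h t powr p + 4 * norm (x t) powr p)"
          by simp
      qed
      also have "\<dots> = c / 2 * g j + 1 / (2 * c) * (C * (1 / n) + 4 * m j)"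
        unfolding block_integral_linear[OF \<beta> GI KI] block_integral_linear[OF \<beta> hI xI] hj[OF j] g_def m_def ..
      finally have "2 * \<bar>b j\<bar> \<le> 2 * (c / 2 * g j + 1 / (2 * c) * (C * (1 / n) + 4 * m j))"
        by (rule mult_left_mono) simp
      also have "\<dots> = c * g j + (C * (1 / n) + 4 * m j) / c"
      proof -
        have "2 * (c / 2 * g j + 1 / (2 * c) * k) = c * g j + k / c" for k
          using c by (simp add: field_simps)
        then show ?thesis .
      qed
      finally show "2 * \<bar>b j\<bar> \<le> c * g j + (C / n + 4 * m j) / c" by simp
    qed
    have gle: "g j \<le> D \<eta> / n + \<eta> * m j" if j: "j < n" and \<eta>: "\<eta> > 0" for j \<eta>
    proof -
      have "g j \<le> block_integral M \<beta> j (\<lambda>t. D \<eta> * h t powr p + \<eta> * norm (x t) powr p)"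
        unfolding g_def using D(2)[OF \<eta>] hI xI
        by (intro block_integral_mono[OF \<beta> GI]) (auto simp: G_def simp flip: nu)
      also have "\<dots> = D \<eta> * (1 / n) + \<eta> * m j"
        unfolding block_integral_linear[OF \<beta> hI xI] hj[OF j] m_def ..
      finally show ?thesis by simp
    qed
    have W0: "0 \<le> 2 + (\<Sum>j<n. g j) + signed_sum {..<n} b S" for S
      unfolding W[symmetric] by (intro Bochner_Integration.integral_nonneg) simp
    have "(\<Sum>j<n. m j) = 1" using sum_block_integral[OF \<beta> \<beta>n xI] x1 by (simp add: m_def)
    then have "block_estimates C D n b g m"
      unfolding block_estimates_def using m0 g0 gpos bsq gle W0 by blast
    from avg[rule_format, OF this] show ?thesis unfolding Lp_seminorm_def W .
  qed
  show thesis by (rule that[of f n]) (use fS gt in blast)+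
qed

text \<open>Existence itself fails, not merely uniqueness: disjoint vectors exclude every
  \<open>r\<close> above \<open>2 powr (1 / p)\<close>, signed vectors every other
  \<open>r\<close>.\<close>

lemma no_rendezvous_number_Lp_sphere:
  fixes M :: "'b measure"
  assumes p: "p > 2" and bw: "\<forall>n\<ge>1. \<exists>h \<beta>. block_weight p M n h \<beta>"
  shows "\<not> rendezvous_number (Lp_sphere p M :: ('b \<Rightarrow> 'a::euclidean_space) set)
      (\<lambda>f g. Lp_seminorm p M (\<lambda>t. f t - g t)) r"
proof
  assume r: "rendezvous_number (Lp_sphere p M :: ('b \<Rightarrow> 'a) set) (\<lambda>f g. Lp_seminorm p M (\<lambda>t. f t - g t)) r"
  have le: "r \<le> 2 powr (1 / p)" using p by (intro rendezvous_number_Lp_sphere_le[OF _ bw r]) auto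
  obtain e :: 'a where "e \<in> Basis" using nonempty_Basis by blast
  then have e: "norm e = 1" by simp
  obtain n and f :: "nat set \<Rightarrow> 'b \<Rightarrow> 'a" where
    sphere: "\<forall>S. f S \<in> Lp_sphere p M" and
    gt: "\<forall>x\<in>Lp_sphere p M. 2 ^ n * 2 powr (1 / p) < (\<Sum>S\<in>Pow {..<n}. Lp_seminorm p M (\<lambda>t. f S t - x t))"
    by (rule signed_block_vector_average_gt[OF p bw e])
  obtain x where x: "x \<in> Lp_sphere p M"
    "(\<Sum>S\<in>Pow {..<n}. Lp_seminorm p M (\<lambda>t. f S t - x t)) = real (card (Pow {..<n})) * r"
    by (rule rendezvous_number_finite_family[OF r, of "Pow {..<n}" f]) (use sphere in auto)
  have "2 ^ n * 2 powr (1 / p) < 2 ^ n * r" using gt x by (auto simp: card_Pow)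
  then show False using le by simp
qed

section \<open>Block weights for the two concrete measures\<close>

text \<open>The blocks are the residue classes modulo \<open>n\<close>. Halving the mass along each
  class keeps the weight positive everywhere and makes every block a geometric series.\<close>

lemma block_weight_count_space:
  assumes p: "p > 0" and n: "n \<ge> 1"
  shows "block_weight p (count_space UNIV) n
    (\<lambda>i. (1 / real n * (1 / 2) ^ Suc (i div n)) powr (1 / p)) (\<lambda>i. i mod n)"
proof -
  define w where "w i = 1 / real n * (1 / 2) ^ Suc (i div n)" for i
  have w0: "0 < w i" for i using n by (simp add: w_def)
  have pw: "(w i powr (1 / p)) powr p = w i" for i using p w0[of i] by (simp add: powr_powr)
  have sums: "(\<lambda>i. indicator {j} (i mod n) * w i) sums (1 / real n)" if j: "j < n" for j
  proof -
    \<comment> \<open>\<open>k * n + j\<close> enumerates block \<open>j\<close>; all other terms of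
      the series vanish, so it may be reindexed.\<close>
    have mono: "strict_mono (\<lambda>k. k * n + j)" using n by (intro strict_monoI) simp
    have "(\<lambda>k. 1 / real n * (1 / 2) ^ Suc k) sums (1 / real n * 1)"
      by (intro sums_mult power_half_series)
    moreover have "(\<lambda>k. indicator {j} ((k * n + j) mod n) * w (k * n + j)) = (\<lambda>k. 1 / real n * (1 / 2) ^ Suc k)"
      using j n by (auto simp: w_def)
    moreover have "indicator {j} (i mod n) * w i = 0" if "i \<notin> range (\<lambda>k. k * n + j)" for i
    proof -
      have "i mod n \<noteq> j"
      proof
        assume "i mod n = j"
        then have "i = i div n * n + j" using div_mult_mod_eq[of i n] by simp
        then show False using that by blast
      qed
      then show ?thesis by simp
    qed
    ultimately show ?thesis using sums_mono_reindex[OF mono, of "\<lambda>i. indicator {j} (i mod n) * w i"] by simp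
  qed
  have "(\<lambda>i. \<Sum>j<n. indicator {j} (i mod n) * w i) = w"
  proof
    fix i
    have "(\<Sum>j<n. indicator {j} (i mod n) * w i) = (\<Sum>j\<in>{..<n}. if j = i mod n then w i else 0)"
      by (intro sum.cong) (auto simp: indicator_def)
    then show "(\<Sum>j<n. indicator {j} (i mod n) * w i) = w i" using n by simp
  qed
  moreover have "summable (\<lambda>i. \<Sum>j<n. indicator {j} (i mod n) * w i)"
    using sums by (intro summable_sum) (auto dest: sums_summable)
  ultimately have "summable w" by simp
  then have wI: "integrable (count_space UNIV) w"
    using w0 by (simp add: integrable_count_space_nat_iff less_imp_le)
  have "block_integral (count_space UNIV) (\<lambda>i. i mod n) j w = 1 / real n" if "j < n" for j
    unfolding block_integral_def
    using integral_count_space_nat[OF integrable_block[OF _ wI, of "\<lambda>i. i mod n" j]] sums_unique[OF sums[OF that]] by simp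
  moreover have "w i \<noteq> 0" for i using w0[of i] by simp
  ultimately show ?thesis
    using n wI unfolding block_weight_def w_def[symmetric] pw by auto
qed

text \<open>The blocks are \<open>n\<close> consecutive intervals of equal length.\<close>

lemma block_weight_unit_interval:
  assumes n: "n \<ge> 1"
  shows "block_weight p (lebesgue_on {0..1}) n (\<lambda>_. 1) (\<lambda>t. nat (\<lceil>real n * t\<rceil> - 1))"
proof -
  let ?\<beta> = "\<lambda>t. nat (\<lceil>real n * t\<rceil> - 1)"
  have \<beta>: "?\<beta> \<in> measurable (lebesgue_on {0..1}) (count_space UNIV)"
  proof (rule measurable_compose[where N = borel and g = "\<lambda>t. nat (\<lceil>real n * t\<rceil> - 1)"])
    show "(\<lambda>t. t) \<in> borel_measurable (lebesgue_on {0..1::real})" 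
      using id_borel_measurable_lebesgue_on[of "{0..1::real}"] by (simp add: id_def)
    show "(\<lambda>t. nat (\<lceil>real n * t\<rceil> - 1)) \<in> borel \<rightarrow>\<^sub>M count_space UNIV" by measurable
  qed
  have less: "?\<beta> t < n" if "t \<in> {0..1}" for t
  proof -
    have "real n * t \<le> real n * 1" using that by (intro mult_left_mono) auto
    then have "\<lceil>real n * t\<rceil> \<le> int n" by (simp add: ceiling_le_iff)
    then show ?thesis using n by linarith
  qed
  have "block_integral (lebesgue_on {0..1}) ?\<beta> j (\<lambda>t. 1 powr p) = 1 / real n" if j: "j < n" for j
  proof -
    define a b where "a = real j / real n" and "b = real (Suc j) / real n"
    have ab: "0 \<le> a" "a \<le> b" "b \<le> 1" "b - a = 1 / real n" "j = 0 \<Longrightarrow> a = 0"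
      using j n by (auto simp: a_def b_def divide_right_mono simp flip: diff_divide_distrib)
    \<comment> \<open>At \<open>t = 0\<close> the function \<open>nat\<close> truncates -1 to 0, so
      the point 0 joins the first block, which is therefore closed on the left.\<close>
    define A where "A = (if j = 0 then {0..b} else {a<..b})"
    have A: "A \<subseteq> {0..1}" using ab by (auto simp: A_def)
    have "indicator {j} (?\<beta> t) = (indicator A t :: real)" if t: "t \<in> {0..1}" for t
    proof -
      have "?\<beta> t = j \<longleftrightarrow> t \<in> A"
      proof (cases "j = 0")
        case True
        have "?\<beta> t = 0 \<longleftrightarrow> \<lceil>real n * t\<rceil> \<le> 1" by linarith
        also have "\<dots> \<longleftrightarrow> real n * t \<le> 1" by (simp add: ceiling_le_iff)
        finally show ?thesis using True t n by (simp add: A_def a_def b_def field_simps)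
      next
        case False
        then have "?\<beta> t = j \<longleftrightarrow> \<lceil>real n * t\<rceil> = int (Suc j)" by linarith
        also have "\<dots> \<longleftrightarrow> real j < real n * t \<and> real n * t \<le> real (Suc j)" by (simp add: ceiling_eq_iff)
        finally show ?thesis using False n by (simp add: A_def a_def b_def field_simps)
      qed
      then show ?thesis by (auto simp: indicator_def)
    qed
    then have "block_integral (lebesgue_on {0..1}) ?\<beta> j (\<lambda>t. 1 powr p) = (LINT t|lebesgue_on {0..1}. indicator A t)"
      unfolding block_integral_def by (intro Bochner_Integration.integral_cong) (auto simp: space_restrict_space)
    also have "\<dots> = measure (lebesgue_on {0..1}) A" using A by (simp add: space_restrict_space Int_absorb2)
    also have "\<dots> = measure lebesgue A" using A by (intro measure_restrict_space) auto
    also have "\<dots> = 1 / real n" using ab by (auto simp: A_def)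
    finally show ?thesis .
  qed
  moreover have "integrable (lebesgue_on {0..1}) (\<lambda>t::real. 1 powr p)"
    by simp
  ultimately show ?thesis using \<beta> less unfolding block_weight_def by (auto simp: space_restrict_space)
qed

section \<open>Transfer to the sequence and function spaces\<close>

text \<open>The two distances are known to agree on the space, not on arbitrary sequences; hence the
  pullback along the identity.\<close>

lemma not_average_distance_property_ell:
  assumes p: "p > 2"
  shows "\<not> average_distance_property (ell_space p :: (nat \<Rightarrow> 'a::euclidean_space) set) ell_diff (ell_norm p)"
proof
  let ?M = "count_space UNIV :: nat measure"
  assume "average_distance_property (ell_space p :: (nat \<Rightarrow> 'a) set) ell_diff (ell_norm p)"
  then obtain r where r: "rendezvous_number (unit_sphere (ell_space p :: (nat \<Rightarrow> 'a) set) (ell_norm p))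
      (\<lambda>x y. ell_norm p (ell_diff x y)) r"
    unfolding average_distance_property_def by blast
  have sphere: "unit_sphere (ell_space p :: (nat \<Rightarrow> 'a) set) (ell_norm p) = Lp_sphere p ?M"
    by (auto simp: unit_sphere_def Lp_sphere_def ell_norm_eq_Lp_seminorm simp flip: ell_space_eq_Lp_fun)
  have "rendezvous_number (Lp_sphere p ?M :: (nat \<Rightarrow> 'a) set) (\<lambda>f g. Lp_seminorm p ?M (\<lambda>t. f t - g t)) r"
  proof (rule rendezvous_number_pullback[OF r, of _ "\<lambda>x. x"], unfold sphere)
    fix x y :: "nat \<Rightarrow> 'a" assume "x \<in> Lp_sphere p ?M" "y \<in> Lp_sphere p ?M"
    then have "(\<lambda>t. x t - y t) \<in> ell_space p"
      using p unfolding ell_space_eq_Lp_fun by (intro Lp_fun_diff) (auto simp: Lp_sphere_def)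
    then show "ell_norm p (ell_diff x y) = Lp_seminorm p ?M (\<lambda>t. x t - y t)"
      by (simp add: ell_diff_def ell_norm_eq_Lp_seminorm)
  qed auto
  moreover have "\<forall>n\<ge>1. \<exists>h \<beta>. block_weight p ?M n h \<beta>"
    by (intro allI impI exI, rule block_weight_count_space) (use p in auto)
  ultimately show False using no_rendezvous_number_Lp_sphere[OF p, of ?M r, where 'a = 'a] by simp
qed

text \<open>By \<open>Lp_diff_class\<close> and \<open>Lp_norm_class\<close>, passing to classes
  preserves distances, and it maps \<open>Lp_sphere\<close> onto the unit sphere of the
  quotient.\<close>

lemma not_average_distance_property_Lp:
  fixes M :: "'b measure"
  assumes p: "p > 2" and bw: "\<forall>n\<ge>1. \<exists>h \<beta>. block_weight p M n h \<beta>"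
  shows "\<not> average_distance_property (Lp_space p M :: ('b \<Rightarrow> 'a::euclidean_space) set set) (Lp_diff p M) (Lp_norm p M)"
proof
  assume "average_distance_property (Lp_space p M :: ('b \<Rightarrow> 'a) set set) (Lp_diff p M) (Lp_norm p M)"
  then obtain r where r: "rendezvous_number (unit_sphere (Lp_space p M :: ('b \<Rightarrow> 'a) set set) (Lp_norm p M))
      (\<lambda>x y. Lp_norm p M (Lp_diff p M x y)) r"
    unfolding average_distance_property_def by blast
  have "rendezvous_number (Lp_sphere p M :: ('b \<Rightarrow> 'a) set) (\<lambda>f g. Lp_seminorm p M (\<lambda>t. f t - g t)) r"
  proof (rule rendezvous_number_pullback[OF r, of _ "\<lambda>f. Lp_rel p M `` {f}"])
    show "Lp_rel p M `` {f} \<in> unit_sphere (Lp_space p M) (Lp_norm p M)" if "f \<in> Lp_sphere p M" for f :: "'b \<Rightarrow> 'a"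
      using that by (auto simp: Lp_sphere_def unit_sphere_def Lp_space_def Lp_norm_class intro: quotientI)
    show "\<exists>f\<in>Lp_sphere p M. F = Lp_rel p M `` {f}" if F: "F \<in> unit_sphere (Lp_space p M) (Lp_norm p M)"
      for F :: "('b \<Rightarrow> 'a) set"
    proof -
      obtain f where f: "f \<in> Lp_fun p M" "F = Lp_rel p M `` {f}"
        using F unfolding unit_sphere_def Lp_space_def by (blast elim: quotientE)
      then show ?thesis using F by (auto simp: unit_sphere_def Lp_sphere_def Lp_norm_class)
    qed
    show "Lp_norm p M (Lp_diff p M (Lp_rel p M `` {f}) (Lp_rel p M `` {g})) = Lp_seminorm p M (\<lambda>t. f t - g t)"
      if "f \<in> Lp_sphere p M" "g \<in> Lp_sphere p M" for f g :: "'b \<Rightarrow> 'a"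
      using that p by (simp add: Lp_sphere_def Lp_diff_class Lp_norm_class Lp_fun_diff)
  qed
  then show False using no_rendezvous_number_Lp_sphere[OF p bw, of r, where 'a = 'a] by simp
qed

theorem theorem1:
  fixes p :: real
  assumes "p > 2"
  shows
    "\<not> average_distance_property (ell_space p :: (nat \<Rightarrow> real) set) ell_diff (ell_norm p) \<and>
     \<not> average_distance_property (ell_space p :: (nat \<Rightarrow> complex) set) ell_diff (ell_norm p) \<and>
     \<not> average_distance_property (Lp_space p (lebesgue_on {0..1}) :: (real \<Rightarrow> real) set set)
         (Lp_diff p (lebesgue_on {0..1})) (Lp_norm p (lebesgue_on {0..1})) \<and>
     \<not> average_distance_property (Lp_space p (lebesgue_on {0..1}) :: (real \<Rightarrow> complex) set set)
         (Lp_diff p (lebesgue_on {0..1})) (Lp_norm p (lebesgue_on {0..1}))"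
proof -
  have bw: "\<forall>n\<ge>1. \<exists>h \<beta>. block_weight p (lebesgue_on {0..1::real}) n h \<beta>"
    by (intro allI impI exI, rule block_weight_unit_interval)
  show ?thesis
    by (intro conjI not_average_distance_property_ell not_average_distance_property_Lp assms bw)
qed

end
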